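(* Let $K$ be an algebraically closed field and let $Q=(Q_0,Q_1)$ be a connected quiver such that, for every finite subset $P_0'\subseteq Q_0$, the closure $\overline{P_0'}^Q$ of $P_0'$ under $Q$ is a finite acyclic quiver. Then for every finite dimensional $K$-linear representation $\mathcal X$ of $Q$: if $\mathrm{Ext}^n_{KQ}(G(\mathcal X),KQ)=0$ for all $n\geq 1$, then $G(\mathcal X)$ is a projective $KQ$-module.
   Context: A quiver $Q=(Q_0,Q_1)$ is a directed graph (possibly infinite) with vertex set $Q_0$, arrow set $Q_1$, and each arrow $a$ has source $s(a)$ and target $t(a)$. A path is a finite sequence of arrows $a_0a_1\cdots a_n$ with $t(a_i)=s(a_{i+1})$; for each vertex $v$ there is a trivial path $e_v$ of length $0$. $Q$ is acyclic if it has no nontrivial path with equal source and target; connected if its underlying undirected graph is connected; finite if $Q_0,Q_1$ are finite. The path algebra $KQ$ is the $K$-vector space with basis all paths, with product of two paths equal to their concatenation if the target of the first equals the source of the second and $0$ otherwise (extended bilinearly); if $Q_0$ is infinite, $KQ$ has no identity. Modules are right modules; a $KQ$-module $P$ is projective if every epimorphism of $KQ$-modules onto $P$ splits (equivalently, $\mathrm{Hom}_{KQ}(P,-)$ is exact). A $K$-linear representation $\mathcal X$ of $Q$ assigns a $K$-vector space $\mathcal X_v$ to each $v\in Q_0$ and a $K$-linear map $\mathcal X_a:\mathcal X_{s(a)}\to\mathcal X_{t(a)}$ to each $a\in Q_1$; it is finite dimensional if each $\mathcal X_v$ is finite dimensional. $G(\mathcal X)$ is the $KQ$-module with underlying space $\bigoplus_{v\in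 Q_0}\mathcal X_v$, where for $m=\sum_v x_v$ (with $x_v\in\mathcal X_v$, almost all zero), $m e_w:=x_w$ and $m a:=\mathcal X_a(m e_{s(a)})$, extended by distributivity. For $P_0'\subseteq Q_0$, the closure $\overline{P_0'}^Q$ is the subquiver whose vertices are all $v\in Q_0$ reachable by a path in $Q$ from some member of $P_0'$ (including members of $P_0'$ via trivial paths), and whose arrows are all $a\in Q_1$ whose source is such a vertex. *)

theory Defs
  imports Complex_Main "HOL-Computational_Algebra.Polynomial" "HOL-Library.Function_Algebras"
begin

section \<open>Algebraically closed fields\<close>

definition alg_closed :: "'k::field itself \<Rightarrow> bool" where
  "alg_closed _ \<longleftrightarrow> (\<forall>p::'k poly. degree p > 0 \<longrightarrow> (\<exists>x. poly p x = 0))"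

section \<open>Quivers and paths\<close>

record ('v, 'a) quiver =
  verts :: "'v set"
  arrs :: "'a set"
  src :: "'a \<Rightarrow> 'v"
  tgt :: "'a \<Rightarrow> 'v"

definition is_quiver :: "('v, 'a) quiver \<Rightarrow> bool" where
  "is_quiver Q \<longleftrightarrow> (\<forall>a\<in>arrs Q. src Q a \<in> verts Q \<and> tgt Q a \<in> verts Q)"

text \<open>A path is encoded as a pair (starting vertex, list of arrows); the trivial path
  e_v is (v, []).\<close>
type_synonym ('v, 'a) qpath = "'v \<times> 'a list"

fun arrows_chain :: "('v, 'a) quiver \<Rightarrow> 'a list \<Rightarrow> bool" where
  "arrows_chain Q [] = True"
| "arrows_chain Q [a] = True"
| "arrows_chain Q (a # b # as) = (tgt Q a = src Q b \<and> arrows_chain Q (b # as))"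

definition is_path :: "('v, 'a) quiver \<Rightarrow> ('v, 'a) qpath \<Rightarrow> bool" where
  "is_path Q p \<longleftrightarrow> fst p \<in> verts Q \<and> set (snd p) \<subseteq> arrs Q
     \<and> (snd p \<noteq> [] \<longrightarrow> src Q (hd (snd p)) = fst p) \<and> arrows_chain Q (snd p)"

definition path_tgt :: "('v, 'a) quiver \<Rightarrow> ('v, 'a) qpath \<Rightarrow> 'v" where
  "path_tgt Q p = (if snd p = [] then fst p else tgt Q (last (snd p)))"

definition acyclic_quiver :: "('v, 'a) quiver \<Rightarrow> bool" where
  "acyclic_quiver Q \<longleftrightarrow> (\<forall>p. is_path Q p \<and> snd p \<noteq> [] \<longrightarrow> path_tgt Q p \<noteq> fst p)"

definition finite_quiver :: "('v, 'a) quiver \<Rightarrow> bool" where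
  "finite_quiver Q \<longleftrightarrow> finite (verts Q) \<and> finite (arrs Q)"

text \<open>Connected: nonempty, and the underlying undirected graph is connected.\<close>
definition connected_quiver :: "('v, 'a) quiver \<Rightarrow> bool" where
  "connected_quiver Q \<longleftrightarrow> verts Q \<noteq> {} \<and>
     (\<forall>u\<in>verts Q. \<forall>w\<in>verts Q.
        (u, w) \<in> ({(src Q a, tgt Q a) | a. a \<in> arrs Q} \<union> {(tgt Q a, src Q a) | a. a \<in> arrs Q})\<^sup>*)"

text \<open>Closure of a vertex set P under Q.\<close>
definition closure_quiver :: "('v, 'a) quiver \<Rightarrow> 'v set \<Rightarrow> ('v, 'a) quiver" where
  "closure_quiver Q P =
     (let V = {w. \<exists>p. is_path Q p \<and> fst p \<in> P \<and> path_tgt Q p = w}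
      in \<lparr>verts = V, arrs = {a \<in> arrs Q. src Q a \<in> V}, src = src Q, tgt = tgt Q\<rparr>)"

section \<open>The path algebra KQ\<close>

text \<open>Elements of KQ: finitely supported K-valued functions on paths, supported on paths of Q.\<close>
definition pathalg :: "('v, 'a) quiver \<Rightarrow> (('v, 'a) qpath \<Rightarrow> 'k::field) set" where
  "pathalg Q = {f. finite {p. f p \<noteq> 0} \<and> (\<forall>p. f p \<noteq> 0 \<longrightarrow> is_path Q p)}"

text \<open>Product: bilinear extension of concatenation (coefficient of a path is the sum over
  its decompositions into two consecutive pieces).\<close>
definition pmult :: "('v, 'a) quiver \<Rightarrow> (('v, 'a) qpath \<Rightarrow> 'k::field)
     \<Rightarrow> (('v, 'a) qpath \<Rightarrow> 'k) \<Rightarrow> (('v, 'a) qpath \<Rightarrow> 'k)" where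
  "pmult Q f g = (\<lambda>(v, as). \<Sum>i\<in>{0..length as}.
      f (v, take i as) * g (path_tgt Q (v, take i as), drop i as))"

section \<open>Right KQ-modules\<close>

definition rmodule :: "('v, 'a) quiver \<Rightarrow> 'm::ab_group_add set
     \<Rightarrow> ('m \<Rightarrow> (('v, 'a) qpath \<Rightarrow> 'k::field) \<Rightarrow> 'm) \<Rightarrow> bool" where
  "rmodule Q M act \<longleftrightarrow> 0 \<in> M \<and> (\<forall>x\<in>M. \<forall>y\<in>M. x + y \<in> M) \<and> (\<forall>x\<in>M. - x \<in> M)
     \<and> (\<forall>x\<in>M. \<forall>r\<in>pathalg Q. act x r \<in> M)
     \<and> (\<forall>x\<in>M. \<forall>y\<in>M. \<forall>r\<in>pathalg Q. act (x + y) r = act x r + act y r)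
     \<and> (\<forall>x\<in>M. \<forall>r\<in>pathalg Q. \<forall>r'\<in>pathalg Q. act x (r + r') = act x r + act x r')
     \<and> (\<forall>x\<in>M. \<forall>r\<in>pathalg Q. \<forall>r'\<in>pathalg Q. act (act x r) r' = act x (pmult Q r r'))"

definition mod_hom :: "('v, 'a) quiver
     \<Rightarrow> 'm::ab_group_add set \<Rightarrow> ('m \<Rightarrow> (('v, 'a) qpath \<Rightarrow> 'k::field) \<Rightarrow> 'm)
     \<Rightarrow> 'n::ab_group_add set \<Rightarrow> ('n \<Rightarrow> (('v, 'a) qpath \<Rightarrow> 'k) \<Rightarrow> 'n)
     \<Rightarrow> ('m \<Rightarrow> 'n) \<Rightarrow> bool" where
  "mod_hom Q M actM N actN f \<longleftrightarrow> (\<forall>x\<in>M. f x \<in> N)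
     \<and> (\<forall>x\<in>M. \<forall>y\<in>M. f (x + y) = f x + f y)
     \<and> (\<forall>x\<in>M. \<forall>r\<in>pathalg Q. f (actM x r) = actN (f x) r)"

text \<open>Projective: every epimorphism of KQ-modules onto P splits. The modules E range over
  all modules whose underlying abelian group lives in the type 'e; in the theorem 'e is a
  free type variable, hence universally quantified.\<close>
definition projective_mod :: "('v, 'a) quiver \<Rightarrow> 'm::ab_group_add set
     \<Rightarrow> ('m \<Rightarrow> (('v, 'a) qpath \<Rightarrow> 'k::field) \<Rightarrow> 'm) \<Rightarrow> 'e::ab_group_add itself \<Rightarrow> bool" where
  "projective_mod Q P actP _ \<longleftrightarrow>
     (\<forall>(E :: 'e set) actE f. rmodule Q E actE \<and> mod_hom Q E actE P actP f \<and> f ` E = P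
        \<longrightarrow> (\<exists>g. mod_hom Q P actP E actE g \<and> (\<forall>x\<in>P. f (g x) = x)))"

section \<open>Free modules and Ext\<close>

text \<open>The free module (direct sum of indecomposable projectives e_v KQ) on an index set I with
  vertex labelling lab: the elements are finitely supported families (x_i) with x_i in
  e_(lab i) KQ.\<close>
definition free_carrier :: "('v, 'a) quiver \<Rightarrow> 'i set \<Rightarrow> ('i \<Rightarrow> 'v)
     \<Rightarrow> ('i \<Rightarrow> (('v, 'a) qpath \<Rightarrow> 'k::field)) set" where
  "free_carrier Q I lab = {x. finite {i. x i \<noteq> 0} \<and>
     (\<forall>i. x i \<noteq> 0 \<longrightarrow> i \<in> I \<and> x i \<in> pathalg Q \<and> (\<forall>p. x i p \<noteq> 0 \<longrightarrow> fst p = lab i))}"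

definition free_act :: "('v, 'a) quiver \<Rightarrow> ('i \<Rightarrow> (('v, 'a) qpath \<Rightarrow> 'k::field))
     \<Rightarrow> (('v, 'a) qpath \<Rightarrow> 'k) \<Rightarrow> ('i \<Rightarrow> (('v, 'a) qpath \<Rightarrow> 'k))" where
  "free_act Q x r = (\<lambda>i. pmult Q (x i) r)"

text \<open>Ext^n_{KQ}(M, N) = 0 for all n \<ge> 1, computed from a projective (indeed free) resolution
  ... \<rightarrow> P_2 \<rightarrow> P_1 \<rightarrow> P_0 \<rightarrow> M \<rightarrow> 0 as the cohomology of Hom_{KQ}(P_\<bullet>, N):
  every cocycle f : P_n \<rightarrow> N (i.e. f \<circ> d_(n+1) = 0) is a coboundary g \<circ> d_n.
  Since Ext is independent of the projective resolution, we ask for the existence of one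
  such resolution whose modules live in the type 'i \<Rightarrow> KQ (the type 'i being a free,
  hence universally quantified, type variable of the theorem).\<close>
definition ext_pos_vanish :: "'i itself \<Rightarrow> ('v, 'a) quiver
     \<Rightarrow> 'm::ab_group_add set \<Rightarrow> ('m \<Rightarrow> (('v, 'a) qpath \<Rightarrow> 'k::field) \<Rightarrow> 'm)
     \<Rightarrow> 'n::ab_group_add set \<Rightarrow> ('n \<Rightarrow> (('v, 'a) qpath \<Rightarrow> 'k) \<Rightarrow> 'n) \<Rightarrow> bool" where
  "ext_pos_vanish _ Q M actM N actN \<longleftrightarrow>
    (\<exists>(I :: nat \<Rightarrow> 'i set) (lab :: nat \<Rightarrow> 'i \<Rightarrow> 'v)
       (d :: nat \<Rightarrow> ('i \<Rightarrow> (('v, 'a) qpath \<Rightarrow> 'k)) \<Rightarrow> ('i \<Rightarrow> (('v, 'a) qpath \<Rightarrow> 'k)))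
       (eps :: ('i \<Rightarrow> (('v, 'a) qpath \<Rightarrow> 'k)) \<Rightarrow> 'm).
      let P = (\<lambda>n. free_carrier Q (I n) (lab n)); act = free_act Q in
      mod_hom Q (P 0) act M actM eps \<and> eps ` P 0 = M
      \<and> (\<forall>n. mod_hom Q (P (Suc n)) act (P n) act (d (Suc n)))
      \<and> {x \<in> P 0. eps x = 0} = d 1 ` P 1
      \<and> (\<forall>n\<ge>1. {x \<in> P n. d n x = 0} = d (Suc n) ` P (Suc n))
      \<and> (\<forall>n\<ge>1. \<forall>f. mod_hom Q (P n) act N actN f \<and> (\<forall>y\<in>P (Suc n). f (d (Suc n) y) = 0)
            \<longrightarrow> (\<exists>g. mod_hom Q (P (n - 1)) act N actN g \<and> (\<forall>x\<in>P n. f x = g (d n x)))))"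

section \<open>Representations and the functor G\<close>

definition fd_representation :: "('v, 'a) quiver \<Rightarrow> ('k::field \<Rightarrow> 'x::ab_group_add \<Rightarrow> 'x)
     \<Rightarrow> ('v \<Rightarrow> 'x set) \<Rightarrow> ('a \<Rightarrow> 'x \<Rightarrow> 'x) \<Rightarrow> bool" where
  "fd_representation Q scale X XA \<longleftrightarrow> Vector_Spaces.vector_space scale
     \<and> (\<forall>v\<in>verts Q. module.subspace scale (X v)
          \<and> (\<exists>B. finite B \<and> B \<subseteq> X v \<and> X v \<subseteq> module.span scale B))
     \<and> (\<forall>a\<in>arrs Q. (\<forall>x\<in>X (src Q a). XA a x \<in> X (tgt Q a))
          \<and> (\<forall>x\<in>X (src Q a). \<forall>y\<in>X (src Q a). XA a (x + y) = XA a x + XA a y)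
          \<and> (\<forall>c. \<forall>x\<in>X (src Q a). XA a (scale c x) = scale c (XA a x)))"

text \<open>G(X): underlying space the direct sum of the X_v (finitely supported families).\<close>
definition G_carrier :: "('v, 'a) quiver \<Rightarrow> ('v \<Rightarrow> 'x::ab_group_add set) \<Rightarrow> ('v \<Rightarrow> 'x) set" where
  "G_carrier Q X = {m. finite {v. m v \<noteq> 0} \<and> (\<forall>v. m v \<noteq> 0 \<longrightarrow> v \<in> verts Q \<and> m v \<in> X v)}"

text \<open>Action of a single path p = (v, a_0 ... a_n): m p = X_(a_n) ... X_(a_0) (m e_v),
  placed at the target vertex of p.\<close>
definition G_path_act :: "('v, 'a) quiver \<Rightarrow> ('a \<Rightarrow> 'x \<Rightarrow> 'x) \<Rightarrow> ('v \<Rightarrow> 'x::ab_group_add)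
     \<Rightarrow> ('v, 'a) qpath \<Rightarrow> ('v \<Rightarrow> 'x)" where
  "G_path_act Q XA m p = (\<lambda>w. if w = path_tgt Q p then foldl (\<lambda>x a. XA a x) (m (fst p)) (snd p) else 0)"

definition G_act :: "('v, 'a) quiver \<Rightarrow> ('a \<Rightarrow> 'x \<Rightarrow> 'x) \<Rightarrow> ('k::field \<Rightarrow> 'x::ab_group_add \<Rightarrow> 'x)
     \<Rightarrow> ('v \<Rightarrow> 'x) \<Rightarrow> (('v, 'a) qpath \<Rightarrow> 'k) \<Rightarrow> ('v \<Rightarrow> 'x)" where
  "G_act Q XA scale m r = (\<lambda>w. \<Sum>p\<in>{p. r p \<noteq> 0}. scale (r p) (G_path_act Q XA m p w))"

end

(* Ext^1(M, KQ) = 0 for M = G(X) says that for all linear functionals lam_a on the spaces X_(s a)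
   there is an additive map psi from M to KQ with
     psi(m a) = psi(m) a + lam_a(m_(s a)) e_(t a)   for all arrows a;
   psi is obtained by comparing the lift of the derivation with these values to a free cover of M
   with the homomorphism that Ext^1 = 0 provides. Two choices of lam suffice.
   First, a linear relation among the images of the arrows ending in v would produce e_v in the
   span of the nontrivial paths; so the sum of the maps X_(s a) -> X_v over all arrows a ending
   in v is injective.
   Secondly, along an infinite backward chain of arrows ... -> v_1 -> v_0 with nonzero spaces the
   dimensions decrease by injectivity, hence eventually all maps are bijective, and there are
   nonzero y_n in X_(v_n) with y_(n+1) a_n = y_n. Taking lam_(a_n)(y_(n+1)) = 1 forces psi(y_0) to
   have coefficient 1 at all paths a_(k-1) ... a_0, contradicting finite support.
   Hence the relation "there is an arrow w -> v with X_w nonzero" is well-founded, and along it a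
   section of any epimorphism onto M is built vertex by vertex: on the direct sum of the images of
   the incoming arrows it is prescribed, on a complement it is free. *)
theory Submission
  imports Defs
begin


(* Goals of inductions over function spaces contain eta-redexes, which these two rules
   would unfold pointwise before the algebraic rules get a chance to match. *)
declare plus_fun_apply [simp del] zero_fun_apply [simp del]

section \<open>Finitely supported functions and additive extensions\<close>

lemmas fun_apply = plus_fun_apply zero_fun_apply

text \<open>Serves three purposes: a scalar multiple of a path in KQ, a vector of one
  \<open>X v\<close> inside G(X), and an element of one summand of a free module.\<close>

definition single :: "'i \<Rightarrow> 'b::zero \<Rightarrow> 'i \<Rightarrow> 'b" where
  "single i c = (\<lambda>j. if j = i then c else 0)"

lemma single_same [simp]: "single i c i = c"
  by (simp add: single_def)

lemma single_other [simp]: "j \<noteq> i \<Longrightarrow> single i c j = 0"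
  by (simp add: single_def)

lemma single_zero [simp]: "single i 0 = 0"
  by (auto simp: fun_apply single_def fun_eq_iff)

lemma single_add: "single i (c + d :: 'b::monoid_add) = single i c + single i d"
  by (auto simp: fun_apply single_def fun_eq_iff)

lemma support_single: "{j. single i c j \<noteq> 0} \<subseteq> {i}"
  by (auto simp: single_def)

lemma finite_support_single [simp]: "finite {j. single i c j \<noteq> 0}"
  by (rule finite_subset[OF support_single]) simp

lemma finite_support_add:
  fixes f g :: "'i \<Rightarrow> 'b::monoid_add"
  assumes "finite {i. f i \<noteq> 0}" "finite {i. g i \<noteq> 0}"
  shows "finite {i. (f + g) i \<noteq> 0}"
  by (rule finite_subset[OF _ finite_UnI[OF assms]]) (auto simp: fun_apply)

text \<open>Induction on the support. The condition \<open>C\<close> on the values travels along, so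
  that KQ, G(X) and the free modules all get their induction rules from this one.\<close>

lemma finite_support_induct [consumes 2, case_names zero single]:
  fixes f :: "'i \<Rightarrow> 'b::ab_group_add"
  assumes "finite {i. f i \<noteq> 0}" and "\<forall>i. f i \<noteq> 0 \<longrightarrow> C i (f i)"
    and zero: "P 0"
    and step: "\<And>i c g. c \<noteq> 0 \<Longrightarrow> C i c \<Longrightarrow> finite {j. g j \<noteq> 0} \<Longrightarrow>
      \<forall>j. g j \<noteq> 0 \<longrightarrow> C j (g j) \<Longrightarrow> P g \<Longrightarrow> P (single i c + g)"
  shows "P f"
proof -
  have "\<forall>f. {i. f i \<noteq> 0} = S \<and> (\<forall>i. f i \<noteq> 0 \<longrightarrow> C i (f i)) \<longrightarrow> P f" if "finite S" for S
    using that
  proof (induction S)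
    case empty
    then show ?case using zero by (auto simp: fun_eq_iff zero_fun_def[symmetric] dest!: ext)
  next
    case (insert s S)
    show ?case
    proof (intro allI impI)
      fix f assume f: "{i. f i \<noteq> 0} = insert s S \<and> (\<forall>i. f i \<noteq> 0 \<longrightarrow> C i (f i))"
      define g where "g = f(s := 0)"
      have supp: "{i. g i \<noteq> 0} = S" and C: "\<forall>i. g i \<noteq> 0 \<longrightarrow> C i (g i)"
        using f insert(2) by (auto simp: g_def)
      have "P g" using insert.IH supp C by blast
      moreover have "f = single s (f s) + g" by (auto simp: g_def fun_apply single_def fun_eq_iff)
      moreover have "f s \<noteq> 0" "C s (f s)" using f by auto
      ultimately show "P f" using step[of "f s" s g] C supp insert(1) by auto
    qed
  qed
  then show ?thesis using assms(1,2) by blast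
qed

text \<open>The additive extension of the maps \<open>h i\<close> to finitely supported functions.
  Only addition is asked of the target, because an abstract KQ-module carries no separate scalar
  multiplication.\<close>

definition lsum :: "('i \<Rightarrow> 'b::zero \<Rightarrow> 'c::comm_monoid_add) \<Rightarrow> ('i \<Rightarrow> 'b) \<Rightarrow> 'c" where
  "lsum h f = (\<Sum>i | f i \<noteq> 0. h i (f i))"

lemma lsum_superset:
  assumes "finite S" "{i. f i \<noteq> 0} \<subseteq> S" "\<And>i. h i 0 = 0"
  shows "lsum h f = (\<Sum>i\<in>S. h i (f i))"
  unfolding lsum_def by (rule sum.mono_neutral_left) (use assms in auto)

lemma lsum_zero [simp]: "lsum h 0 = 0"
  by (simp add: lsum_def fun_apply)

lemma lsum_single [simp]:
  assumes "h i 0 = 0"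
  shows "lsum h (single i c) = h i c"
proof (cases "c = 0")
  case False
  then have "{j. single i c j \<noteq> 0} = {i}" by (auto simp: single_def)
  then show ?thesis by (simp add: lsum_def)
qed (simp add: assms)

text \<open>Cancellation may shrink the support of \<open>f + g\<close>, so all sums are taken over
  the union of the two supports. Additivity is asked only at the values that occur, since some maps
  used later are additive only on subspaces.\<close>

lemma lsum_add:
  fixes f g :: "'i \<Rightarrow> 'b::monoid_add"
  assumes "finite {i. f i \<noteq> 0}" "finite {i. g i \<noteq> 0}" "\<And>i. h i 0 = 0"
    and "\<And>i. h i (f i + g i) = h i (f i) + h i (g i)"
  shows "lsum h (f + g) = lsum h f + lsum h g"
proof -
  let ?S = "{i. f i \<noteq> 0} \<union> {i. g i \<noteq> 0}"
  have S: "finite ?S" using assms by simp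
  have "lsum h (f + g) = (\<Sum>i\<in>?S. h i ((f + g) i))"
    by (rule lsum_superset[OF S]) (use assms in \<open>auto simp: fun_apply\<close>)
  also have "\<dots> = (\<Sum>i\<in>?S. h i (f i)) + (\<Sum>i\<in>?S. h i (g i))"
    by (simp add: fun_apply assms sum.distrib)
  also have "(\<Sum>i\<in>?S. h i (f i)) = lsum h f"
    by (rule lsum_superset[OF S, symmetric]) (use assms in auto)
  also have "(\<Sum>i\<in>?S. h i (g i)) = lsum h g"
    by (rule lsum_superset[OF S, symmetric]) (use assms in auto)
  finally show ?thesis .
qed

lemma sum_closed:
  fixes h :: "'i \<Rightarrow> 'b::comm_monoid_add"
  assumes "0 \<in> E" "\<And>x y. x \<in> E \<Longrightarrow> y \<in> E \<Longrightarrow> x + y \<in> E" "\<And>i. i \<in> S \<Longrightarrow> h i \<in> E"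
  shows "sum h S \<in> E"
  using assms(3) by (induction S rule: infinite_finite_induct) (auto simp: assms(1,2))

lemma additive_on_sum:
  fixes h :: "'i \<Rightarrow> 'b::comm_monoid_add" and F :: "'b \<Rightarrow> 'c::comm_monoid_add"
  assumes "0 \<in> E" "\<And>x y. x \<in> E \<Longrightarrow> y \<in> E \<Longrightarrow> x + y \<in> E" "\<And>i. i \<in> S \<Longrightarrow> h i \<in> E"
    and "F 0 = 0" "\<And>x y. x \<in> E \<Longrightarrow> y \<in> E \<Longrightarrow> F (x + y) = F x + F y"
  shows "F (sum h S) = (\<Sum>i\<in>S. F (h i))"
  using assms(3)
proof (induction S rule: infinite_finite_induct)
  case (insert i S)
  then have "sum h S \<in> E" by (intro sum_closed[OF assms(1,2)]) auto
  with insert show ?case by (simp add: assms(5))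
qed (simp_all add: assms(4))

lemma sum_fun_apply: "(\<Sum>i\<in>S. F i) x = (\<Sum>i\<in>S. F i x)" for F :: "'i \<Rightarrow> 'b \<Rightarrow> 'c::comm_monoid_add"
  by (induction S rule: infinite_finite_induct) (auto simp: fun_apply)

section \<open>Paths and the path algebra\<close>

lemma is_path_Nil [simp]: "is_path Q (v, []) \<longleftrightarrow> v \<in> verts Q"
  by (simp add: is_path_def)

lemma path_tgt_Nil [simp]: "path_tgt Q (v, []) = v"
  by (simp add: path_tgt_def)

lemma path_tgt_Cons [simp]: "path_tgt Q (v, a # as) = path_tgt Q (tgt Q a, as)"
  by (simp add: path_tgt_def)

lemma path_tgt_append: "path_tgt Q (v, as @ bs) = path_tgt Q (path_tgt Q (v, as), bs)"
  by (induction as arbitrary: v) auto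

lemma is_path_Cons:
  assumes "is_quiver Q"
  shows "is_path Q (v, a # as) \<longleftrightarrow> a \<in> arrs Q \<and> src Q a = v \<and> is_path Q (tgt Q a, as)"
  using assms by (cases as) (auto simp: is_path_def is_quiver_def)

lemma is_path_append:
  assumes "is_quiver Q"
  shows "is_path Q (v, as @ bs) \<longleftrightarrow> is_path Q (v, as) \<and> is_path Q (path_tgt Q (v, as), bs)"
proof (induction as arbitrary: v)
  case Nil
  then show ?case by (auto simp: is_path_def)
next
  case (Cons a as)
  then show ?case by (auto simp: is_path_Cons[OF assms])
qed

lemma path_tgt_in_verts: "is_quiver Q \<Longrightarrow> is_path Q p \<Longrightarrow> path_tgt Q p \<in> verts Q"
  by (auto simp: is_path_def path_tgt_def is_quiver_def dest!: last_in_set)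

lemma zero_in_pathalg [simp]: "0 \<in> pathalg Q"
  by (simp add: pathalg_def fun_apply)

lemma single_in_pathalg: "is_path Q p \<Longrightarrow> single p c \<in> pathalg Q"
  by (auto simp: pathalg_def) (metis single_other)

lemma add_in_pathalg: "f \<in> pathalg Q \<Longrightarrow> g \<in> pathalg Q \<Longrightarrow> f + g \<in> pathalg Q"
  using finite_support_add[of f g] by (force simp: pathalg_def fun_apply)

lemma minus_in_pathalg: "f \<in> pathalg Q \<Longrightarrow> - f \<in> pathalg Q"
  by (simp add: pathalg_def)

lemma finite_support_pathalg: "f \<in> pathalg Q \<Longrightarrow> finite {p. f p \<noteq> 0}"
  by (simp add: pathalg_def)

lemma pathalg_induct [consumes 1, case_names zero single]:
  assumes "f \<in> pathalg Q" and "P 0"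
    and "\<And>p c g. is_path Q p \<Longrightarrow> g \<in> pathalg Q \<Longrightarrow> P g \<Longrightarrow> P (single p c + g)"
  shows "P f"
proof -
  have "finite {p. f p \<noteq> 0}" "\<forall>p. f p \<noteq> 0 \<longrightarrow> is_path Q p"
    using assms(1) by (auto simp: pathalg_def)
  then show ?thesis
    by (induction rule: finite_support_induct[where C = "\<lambda>p c. is_path Q p"])
      (auto simp: assms(2) pathalg_def intro!: assms(3))
qed

lemma pmult_zero_left [simp]: "pmult Q 0 g = 0"
  by (auto simp: pmult_def fun_apply fun_eq_iff)

lemma pmult_zero_right [simp]: "pmult Q f 0 = 0"
  by (auto simp: pmult_def fun_apply fun_eq_iff)

lemma pmult_add_left: "pmult Q (f + f') g = pmult Q f g + pmult Q f' g"
  by (auto simp: pmult_def fun_apply fun_eq_iff algebra_simps sum.distrib)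

lemma pmult_add_right: "pmult Q f (g + g') = pmult Q f g + pmult Q f g'"
  by (auto simp: pmult_def fun_apply fun_eq_iff algebra_simps sum.distrib)

lemma pmult_diff_left: "pmult Q (f - f') g = pmult Q f g - pmult Q f' g"
  by (auto simp: pmult_def fun_apply fun_eq_iff algebra_simps sum_subtractf)

lemma pmult_single:
  "pmult Q (single (v, as) c) (single (w, bs) d) =
    (if path_tgt Q (v, as) = w then single (v, as @ bs) (c * d) else 0)"
proof (rule ext, clarify)
  fix u cs
  have "pmult Q (single (v, as) c) (single (w, bs) d) (u, cs) =
    (\<Sum>i\<in>{0..length cs}. if i = length as then
       (if u = v \<and> cs = as @ bs \<and> path_tgt Q (v, as) = w then c * d else 0) else 0)"
    unfolding pmult_def prod.case
  proof (rule sum.cong[OF refl])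
    fix i assume i: "i \<in> {0..length cs}"
    \<comment> \<open>Among all cuts of \<open>cs\<close> only the one after
      \<open>length as\<close> arrows can match both factors.\<close>
    have "take i cs = as \<and> drop i cs = bs \<longleftrightarrow> i = length as \<and> cs = as @ bs"
      using i by (metis append_eq_conv_conj append_take_drop_id atLeastAtMost_iff length_take min.absorb2)
    then have "(u, take i cs) = (v, as) \<and> (path_tgt Q (u, take i cs), drop i cs) = (w, bs) \<longleftrightarrow>
        i = length as \<and> u = v \<and> cs = as @ bs \<and> path_tgt Q (v, as) = w"
      by auto
    then show "single (v, as) c (u, take i cs) * single (w, bs) d (path_tgt Q (u, take i cs), drop i cs)
      = (if i = length as then
         (if u = v \<and> cs = as @ bs \<and> path_tgt Q (v, as) = w then c * d else 0) else 0)"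
      unfolding single_def by (smt (verit) mult_zero_left mult_zero_right)
  qed
  also have "\<dots> = (if path_tgt Q (v, as) = w then single (v, as @ bs) (c * d) else 0) (u, cs)"
    by (auto simp: single_def fun_apply)
  finally show "pmult Q (single (v, as) c) (single (w, bs) d) (u, cs) =
    (if path_tgt Q (v, as) = w then single (v, as @ bs) (c * d) else 0) (u, cs)" .
qed

lemma pmult_in_pathalg:
  assumes Q: "is_quiver Q" and f: "f \<in> pathalg Q" and g: "g \<in> pathalg Q"
  shows "pmult Q f g \<in> pathalg Q"
  using f
proof (induction rule: pathalg_induct)
  case (single p c f)
  have "pmult Q (single p c) g \<in> pathalg Q"
    using g
  proof (induction rule: pathalg_induct)
    case (single p' c' g)
    obtain v as w bs where "p = (v, as)" "p' = (w, bs)" by (cases p, cases p')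
    then show ?case using single \<open>is_path Q p\<close>
      by (auto simp: pmult_add_right pmult_single is_path_append[OF Q]
          intro!: add_in_pathalg single_in_pathalg)
  qed simp
  then show ?case using single by (simp add: pmult_add_left add_in_pathalg)
qed simp

text \<open>As KQ may lack an identity, a trivial path is a left identity only on the right ideal
  e_v KQ.\<close>

lemma pmult_vertex_left:
  assumes "\<forall>p. f p \<noteq> 0 \<longrightarrow> fst p = v"
  shows "pmult Q (single (v, []) 1) f = f"
proof (rule ext, clarify)
  fix u cs
  have "pmult Q (single (v, []) 1) f (u, cs) = (\<Sum>i\<in>{0..length cs}. if i = 0 then f (u, cs) else 0)"
    unfolding pmult_def prod.case
    by (rule sum.cong[OF refl]) (use assms in \<open>force simp: single_def\<close>)
  then show "pmult Q (single (v, []) 1) f (u, cs) = f (u, cs)" by simp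
qed

text \<open>Every path in a product with an arrow on the right ends in that arrow. Together with
  \<open>pmult_arrow_snoc\<close> this is how coefficients of split cocycles are read off.\<close>

lemma pmult_arrow_Nil: "pmult Q f (single (v, [a]) c) (u, []) = 0"
  by (simp add: pmult_def)

lemma pmult_arrow_snoc:
  "pmult Q f (single (path_tgt Q (u, cs), [a]) 1) (u, cs @ [a]) = f (u, cs)"
proof -
  have "pmult Q f (single (path_tgt Q (u, cs), [a]) 1) (u, cs @ [a]) =
    (\<Sum>i\<in>{0..Suc (length cs)}. if i = length cs then f (u, cs) else 0)"
    unfolding pmult_def prod.case
  proof (rule sum.cong, simp)
    fix i assume i: "i \<in> {0..Suc (length cs)}"
    have "drop i (cs @ [a]) = [a] \<longleftrightarrow> i = length cs"
    proof
      assume "drop i (cs @ [a]) = [a]"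
      then have "length (drop i (cs @ [a])) = 1" by simp
      then show "i = length cs" using i by (simp; linarith)
    qed simp
    then show "f (u, take i (cs @ [a])) * single (path_tgt Q (u, cs), [a]) 1
        (path_tgt Q (u, take i (cs @ [a])), drop i (cs @ [a])) = (if i = length cs then f (u, cs) else 0)"
      by (auto simp: single_def)
  qed
  then show ?thesis by simp
qed


section \<open>The module of a representation\<close>

locale quiver_rep = vector_space scale
  for scale :: "'k::field \<Rightarrow> 'x::ab_group_add \<Rightarrow> 'x" (infixr \<open>*s\<close> 75) +
  fixes Q :: "('v, 'a) quiver" and X :: "'v \<Rightarrow> 'x set" and XA :: "'a \<Rightarrow> 'x \<Rightarrow> 'x"
  assumes quiver: "is_quiver Q" and rep: "fd_representation Q scale X XA"
begin

abbreviation "M \<equiv> G_carrier Q X"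
abbreviation "actM \<equiv> G_act Q XA scale"
abbreviation transport :: "'x \<Rightarrow> 'a list \<Rightarrow> 'x" where
  "transport \<equiv> foldl (\<lambda>x a. XA a x)"

lemma src_in_verts: "a \<in> arrs Q \<Longrightarrow> src Q a \<in> verts Q"
  and tgt_in_verts: "a \<in> arrs Q \<Longrightarrow> tgt Q a \<in> verts Q"
  using quiver by (auto simp: is_quiver_def)

lemma subspace_X: "v \<in> verts Q \<Longrightarrow> subspace (X v)"
  using rep by (simp add: fd_representation_def)

lemma zero_in_X: "v \<in> verts Q \<Longrightarrow> 0 \<in> X v"
  and add_in_X: "v \<in> verts Q \<Longrightarrow> x \<in> X v \<Longrightarrow> y \<in> X v \<Longrightarrow> x + y \<in> X v"
  and scale_in_X: "v \<in> verts Q \<Longrightarrow> x \<in> X v \<Longrightarrow> c *s x \<in> X v"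
  and diff_in_X: "v \<in> verts Q \<Longrightarrow> x \<in> X v \<Longrightarrow> y \<in> X v \<Longrightarrow> x - y \<in> X v"
  and minus_in_X: "v \<in> verts Q \<Longrightarrow> x \<in> X v \<Longrightarrow> - x \<in> X v"
  using subspace_X[of v] by (auto intro: subspace_0 subspace_add subspace_scale subspace_diff subspace_neg)

lemma XA_in_X: "a \<in> arrs Q \<Longrightarrow> x \<in> X (src Q a) \<Longrightarrow> XA a x \<in> X (tgt Q a)"
  and XA_add: "a \<in> arrs Q \<Longrightarrow> x \<in> X (src Q a) \<Longrightarrow> y \<in> X (src Q a) \<Longrightarrow>
    XA a (x + y) = XA a x + XA a y"
  and XA_scale: "a \<in> arrs Q \<Longrightarrow> x \<in> X (src Q a) \<Longrightarrow> XA a (c *s x) = c *s XA a x"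
  using rep by (auto simp: fd_representation_def)

lemma XA_zero: "a \<in> arrs Q \<Longrightarrow> XA a 0 = 0"
  using XA_scale[of a 0 0] zero_in_X[OF src_in_verts, of a] by simp

lemma XA_minus: "a \<in> arrs Q \<Longrightarrow> x \<in> X (src Q a) \<Longrightarrow> XA a (- x) = - XA a x"
  using XA_scale[of a x "- 1"] by simp

lemma transport_in_X: "is_path Q (v, as) \<Longrightarrow> x \<in> X v \<Longrightarrow> transport x as \<in> X (path_tgt Q (v, as))"
  by (induction as arbitrary: v x) (auto simp: is_path_Cons[OF quiver] XA_in_X)

lemma transport_add: "is_path Q (v, as) \<Longrightarrow> x \<in> X v \<Longrightarrow> y \<in> X v \<Longrightarrow>
    transport (x + y) as = transport x as + transport y as"
  by (induction as arbitrary: v x y) (auto simp: is_path_Cons[OF quiver] XA_in_X XA_add)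

lemma transport_scale: "is_path Q (v, as) \<Longrightarrow> x \<in> X v \<Longrightarrow> transport (c *s x) as = c *s transport x as"
  by (induction as arbitrary: v x) (auto simp: is_path_Cons[OF quiver] XA_in_X XA_scale)

lemma transport_zero: "is_path Q (v, as) \<Longrightarrow> transport 0 as = 0"
  by (induction as arbitrary: v) (auto simp: is_path_Cons[OF quiver] XA_zero)

lemma zero_in_M: "0 \<in> M"
  by (simp add: G_carrier_def fun_apply)

lemma component_in_X: "m \<in> M \<Longrightarrow> v \<in> verts Q \<Longrightarrow> m v \<in> X v"
  by (cases "m v = 0") (auto simp: G_carrier_def zero_in_X)

lemma component_outside: "m \<in> M \<Longrightarrow> v \<notin> verts Q \<Longrightarrow> m v = 0"
  by (auto simp: G_carrier_def)

lemma single_in_M: "v \<in> verts Q \<Longrightarrow> x \<in> X v \<Longrightarrow> single v x \<in> M"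
  by (auto simp: G_carrier_def single_def)

lemma add_in_M:
  assumes "m \<in> M" "m' \<in> M"
  shows "m + m' \<in> M"
proof -
  have "finite {v. (m + m') v \<noteq> 0}"
    by (rule finite_support_add) (use assms in \<open>simp_all add: G_carrier_def\<close>)
  moreover have "v \<in> verts Q \<and> (m + m') v \<in> X v" if "(m + m') v \<noteq> 0" for v
    using that assms by (cases "v \<in> verts Q") (simp_all add: fun_apply component_in_X component_outside add_in_X)
  ultimately show ?thesis by (simp add: G_carrier_def)
qed

lemma M_induct [consumes 1, case_names zero single]:
  assumes "m \<in> M" and "P 0"
    and "\<And>v x m. v \<in> verts Q \<Longrightarrow> x \<in> X v \<Longrightarrow> m \<in> M \<Longrightarrow> P m \<Longrightarrow> P (single v x + m)"
  shows "P m"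
proof -
  have "finite {v. m v \<noteq> 0}" "\<forall>v. m v \<noteq> 0 \<longrightarrow> v \<in> verts Q \<and> m v \<in> X v"
    using assms(1) by (auto simp: G_carrier_def)
  then show ?thesis
    by (induction rule: finite_support_induct[where C = "\<lambda>v x. v \<in> verts Q \<and> x \<in> X v"])
      (auto simp: assms(2) G_carrier_def intro!: assms(3))
qed

text \<open>Reading the pointwise sum as an additive extension in \<open>r\<close> makes the lemmas
  on \<open>lsum\<close> available and reduces the module laws to single paths.\<close>

lemma actM_eq_lsum:
  "actM m r = lsum (\<lambda>p c. single (path_tgt Q p) (c *s transport (m (fst p)) (snd p))) r"
  by (auto simp: G_act_def lsum_def sum_fun_apply fun_eq_iff G_path_act_def single_def intro!: sum.cong)

lemma actM_single: "actM m (single (v, as) c) = single (path_tgt Q (v, as)) (c *s transport (m v) as)"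
  by (simp add: actM_eq_lsum)

lemma actM_zero_right [simp]: "actM m 0 = 0"
  by (simp add: actM_eq_lsum)

lemma actM_add_right:
  assumes "r \<in> pathalg Q" "r' \<in> pathalg Q"
  shows "actM m (r + r') = actM m r + actM m r'"
  unfolding actM_eq_lsum
  by (rule lsum_add) (use assms in \<open>auto simp: finite_support_pathalg scale_left_distrib single_add\<close>)

text \<open>\<open>XA\<close> is unconstrained outside \<open>arrs Q\<close>, so 0 is known to go to
  0 only along paths of Q; hence the restriction on \<open>r\<close>.\<close>

lemma actM_zero_left: "r \<in> pathalg Q \<Longrightarrow> actM 0 r = 0"
proof (induction rule: pathalg_induct)
  case (single p c g)
  have "actM 0 (single p c) = 0"
    using single(1) by (cases p) (simp add: actM_single fun_apply transport_zero)
  then show ?case using single by (simp add: actM_add_right single_in_pathalg)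
qed simp

lemma actM_in_M: 
  assumes "m \<in> M" "r \<in> pathalg Q"
  shows "actM m r \<in> M"
  using assms(2)
proof (induction rule: pathalg_induct)
  case zero
  then show ?case by (simp add: zero_in_M)
next
  case (single p c g)
  obtain v as where p: "p = (v, as)" by (cases p)
  have "v \<in> verts Q" using single(1) by (simp add: p is_path_def)
  then have "single (path_tgt Q (v, as)) (c *s transport (m v) as) \<in> M"
    using single(1)[unfolded p] by (intro single_in_M scale_in_X path_tgt_in_verts[OF quiver] transport_in_X
        component_in_X[OF assms(1)])
  then show ?case using single
    by (simp add: p actM_add_right single_in_pathalg actM_single add_in_M)
qed

lemma actM_add_left:
  assumes "m \<in> M" "m' \<in> M" "r \<in> pathalg Q"
  shows "actM (m + m') r = actM m r + actM m' r"
  using assms(3)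
proof (induction rule: pathalg_induct)
  case (single p c g)
  obtain v as where p: "p = (v, as)" by (cases p)
  have "v \<in> verts Q" using single(1) by (simp add: p is_path_def)
  then have "actM (m + m') (single p c) = actM m (single p c) + actM m' (single p c)"
    using single(1)
    by (simp add: p actM_single fun_apply transport_add component_in_X assms scale_right_distrib single_add)
  then show ?case using single by (simp add: actM_add_right single_in_pathalg ac_simps)
qed simp

end

section \<open>Cocycles with values in the path algebra\<close>

text \<open>The functionals prescribe a derivation on arrows: m and a are sent to lam_a(m_(s a))
  e_(t a).\<close>

locale arrow_functionals = quiver_rep scale Q X XA
  for scale :: "'k::field \<Rightarrow> 'x::ab_group_add \<Rightarrow> 'x" (infixr \<open>*s\<close> 75)
  and Q :: "('v, 'a) quiver" and X :: "'v \<Rightarrow> 'x set" and XA :: "'a \<Rightarrow> 'x \<Rightarrow> 'x" +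
  fixes lam :: "'a \<Rightarrow> 'x \<Rightarrow> 'k"
  assumes lam_add: "lam a (x + y) = lam a x + lam a y"
    and lam_scale: "lam a (c *s x) = c * lam a x"
begin

lemma lam_zero [simp]: "lam a 0 = 0"
  using lam_scale[of a 0 0] by simp

text \<open>The Leibniz rule unrolled: for a path a_0 ... a_n this is the sum over i of lam_(a_i)(x
  a_0 ... a_(i-1)) times the remaining path a_(i+1) ... a_n.\<close>

fun leibniz :: "'x \<Rightarrow> 'a list \<Rightarrow> ('v, 'a) qpath \<Rightarrow> 'k" where
  "leibniz x [] = 0"
| "leibniz x (a # as) = single (tgt Q a, as) (lam a x) + leibniz (XA a x) as"

lemma leibniz_add: "is_path Q (v, as) \<Longrightarrow> x \<in> X v \<Longrightarrow> y \<in> X v \<Longrightarrow>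
    leibniz (x + y) as = leibniz x as + leibniz y as"
  by (induction as arbitrary: v x y)
    (auto simp: is_path_Cons[OF quiver] XA_in_X XA_add lam_add single_add algebra_simps)

lemma leibniz_zero: "is_path Q (v, as) \<Longrightarrow> leibniz 0 as = 0"
  by (induction as arbitrary: v) (auto simp: is_path_Cons[OF quiver] XA_zero)

lemma leibniz_scale: "is_path Q (v, as) \<Longrightarrow> x \<in> X v \<Longrightarrow> leibniz (c *s x) as q = c * leibniz x as q"
proof (induction as arbitrary: v x)
  case (Cons a as)
  then show ?case
    by (auto simp: is_path_Cons[OF quiver] XA_in_X XA_scale lam_scale fun_apply single_def distrib_left)
qed (simp add: fun_apply)

lemma leibniz_in_pathalg: "is_path Q (v, as) \<Longrightarrow> leibniz x as \<in> pathalg Q"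
  by (induction as arbitrary: v x)
    (auto simp: is_path_Cons[OF quiver] intro!: add_in_pathalg single_in_pathalg)

text \<open>The sum over the arrows is cut after \<open>as\<close>. The vertex \<open>v\<close> can
  be arbitrary: for empty \<open>as\<close> the product is zero, otherwise the target of
  \<open>as\<close> does not depend on \<open>v\<close>.\<close>

lemma leibniz_append:
  "leibniz x (as @ bs) = pmult Q (leibniz x as) (single (path_tgt Q (v, as), bs) 1) + leibniz (transport x as) bs"
proof (induction as arbitrary: x v)
  case (Cons a as)
  show ?case by (simp add: Cons[of "XA a x" "tgt Q a"] pmult_add_left pmult_single ac_simps)
qed simp

lemma pmult_leibniz_mismatch:
  "w \<noteq> path_tgt Q (v, as) \<Longrightarrow> pmult Q (leibniz x as) (single (w, bs) c) = 0"
proof (induction as arbitrary: x v)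
  case (Cons a as)
  then show ?case by (auto simp: pmult_add_left pmult_single)
qed simp

text \<open>The extension of \<open>leibniz\<close> to KQ; by \<open>deriv_pmult\<close> it is a
  1-cocycle on G(X) with values in KQ.\<close>

definition deriv :: "('v \<Rightarrow> 'x) \<Rightarrow> (('v, 'a) qpath \<Rightarrow> 'k) \<Rightarrow> ('v, 'a) qpath \<Rightarrow> 'k" where
  "deriv m = lsum (\<lambda>p c q. c * leibniz (m (fst p)) (snd p) q)"

lemma deriv_zero_right [simp]: "deriv m 0 = 0"
  by (simp add: deriv_def)

lemma deriv_single: "deriv m (single (v, as) c) = (\<lambda>q. c * leibniz (m v) as q)"
  by (simp add: deriv_def zero_fun_def)

lemma deriv_add_right:
  assumes "r \<in> pathalg Q" "r' \<in> pathalg Q"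
  shows "deriv m (r + r') = deriv m r + deriv m r'"
  unfolding deriv_def
  by (rule lsum_add)
    (use assms in \<open>auto simp: finite_support_pathalg fun_eq_iff fun_apply algebra_simps\<close>)

lemma deriv_in_pathalg: "r \<in> pathalg Q \<Longrightarrow> deriv m r \<in> pathalg Q"
proof (induction rule: pathalg_induct)
  case (single p c g)
  obtain v as where p: "p = (v, as)" by (cases p)
  have "(\<lambda>q. c * leibniz (m v) as q) \<in> pathalg Q"
    using leibniz_in_pathalg[of v as "m v"] single(1) p
    by (auto simp: pathalg_def elim: rev_finite_subset)
  then show ?case using single
    by (auto simp: p deriv_add_right single_in_pathalg deriv_single intro: add_in_pathalg)
qed simp

lemma deriv_zero_left: "r \<in> pathalg Q \<Longrightarrow> deriv 0 r = 0"
proof (induction rule: pathalg_induct)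
  case (single p c g)
  obtain v as where p: "p = (v, as)" by (cases p)
  have "deriv 0 (single p c) = 0"
    using single(1) by (simp add: p deriv_single fun_apply leibniz_zero) (simp add: zero_fun_def)
  then show ?case using single by (simp add: deriv_add_right single_in_pathalg)
qed simp

lemma deriv_add_left:
  assumes "m \<in> M" "m' \<in> M" "r \<in> pathalg Q"
  shows "deriv (m + m') r = deriv m r + deriv m' r"
  using assms(3)
proof (induction rule: pathalg_induct)
  case (single p c g)
  obtain v as where p: "p = (v, as)" by (cases p)
  have v: "v \<in> verts Q" using single(1) by (simp add: p is_path_def)
  have "deriv (m + m') (single p c) = deriv m (single p c) + deriv m' (single p c)"
    using single(1) v
    by (simp add: p deriv_single fun_apply leibniz_add component_in_X assms)
      (auto simp: fun_eq_iff fun_apply algebra_simps)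
  then show ?case using single
    by (simp add: deriv_add_right single_in_pathalg ac_simps)
qed simp

lemma pmult_scale_single:
  "pmult Q (\<lambda>q. c * f q) (single p d) = (\<lambda>q. (c * d) * pmult Q f (single p 1) q)"
  by (auto simp: pmult_def fun_eq_iff single_def sum_distrib_left algebra_simps intro!: sum.cong)

text \<open>Additivity in both ring arguments reduces the cocycle identity to two paths, where it is
  \<open>leibniz_append\<close>.\<close>

lemma deriv_pmult:
  assumes m: "m \<in> M" and r: "r \<in> pathalg Q" and r': "r' \<in> pathalg Q"
  shows "deriv m (pmult Q r r') = pmult Q (deriv m r) r' + deriv (actM m r) r'"
  using r
proof (induction rule: pathalg_induct)
  case zero
  then show ?case using r' by (simp add: deriv_zero_left)
next
  case (single p c r)
  obtain v as where p: "p = (v, as)" by (cases p)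
  have v: "v \<in> verts Q" using single(1) by (simp add: p is_path_def)
  have "deriv m (pmult Q (single p c) r') = pmult Q (deriv m (single p c)) r' + deriv (actM m (single p c)) r'"
    using r'
  proof (induction rule: pathalg_induct)
    case (single p' d r')
    obtain w bs where p': "p' = (w, bs)" by (cases p')
    have "deriv m (pmult Q (single p c) (single p' d)) =
        pmult Q (deriv m (single p c)) (single p' d) + deriv (actM m (single p c)) (single p' d)"
    proof (cases "path_tgt Q (v, as) = w")
      case True
      have "leibniz (c *s transport (m v) as) bs = (\<lambda>q. c * leibniz (transport (m v) as) bs q)"
        using single(1) \<open>is_path Q p\<close> True transport_in_X[of v as "m v"]
        by (intro ext leibniz_scale[of w]) (auto simp: p p' component_in_X m v)
      then show ?thesis using True
        by (simp add: p p' pmult_single deriv_single actM_single leibniz_append[of _ as bs v] pmult_scale_single)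
          (auto simp: fun_eq_iff fun_apply algebra_simps)
    next
      \<comment> \<open>If the paths do not compose, every term vanishes: the product, the right
        multiple by \<open>pmult_leibniz_mismatch\<close>, and the last one because
        \<open>actM m\<close> of the first path has no component at \<open>w\<close>.\<close>
      case False
      then have "pmult Q (leibniz (m v) as) (single (w, bs) 1) = 0"
        by (intro pmult_leibniz_mismatch[of w v as]) simp
      then show ?thesis using False single(1)
        by (simp add: p p' pmult_single deriv_single actM_single pmult_scale_single leibniz_zero)
          (auto simp: fun_eq_iff fun_apply)
    qed
    then show ?case using single \<open>is_path Q p\<close>
      by (simp add: pmult_add_right deriv_add_right single_in_pathalg pmult_in_pathalg quiver ac_simps)
  qed simp
  then show ?case using single m r'
    by (simp add: pmult_add_left deriv_add_right single_in_pathalg pmult_in_pathalg quiver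
        actM_add_right deriv_add_left actM_in_M ac_simps)
qed

end


section \<open>Splitting cocycles by means of Ext\<close>

lemma zero_in_free_carrier: "0 \<in> free_carrier Q I lab"
  by (simp add: free_carrier_def fun_apply)

lemma single_in_free_carrier:
  "i \<in> I \<Longrightarrow> y \<in> pathalg Q \<Longrightarrow> \<forall>p. y p \<noteq> 0 \<longrightarrow> fst p = lab i \<Longrightarrow> single i y \<in> free_carrier Q I lab"
  by (auto simp: free_carrier_def single_def fun_apply)

lemma free_carrierD:
  assumes "x \<in> free_carrier Q I lab"
  shows "finite {i. x i \<noteq> 0}" "x i \<in> pathalg Q" "x i p \<noteq> 0 \<Longrightarrow> fst p = lab i" "i \<notin> I \<Longrightarrow> x i = 0"
proof -
  have x: "finite {i. x i \<noteq> 0}" "x i \<noteq> 0 \<Longrightarrow> i \<in> I \<and> x i \<in> pathalg Q \<and> (\<forall>p. x i p \<noteq> 0 \<longrightarrow> fst p = lab i)" for i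
    using assms unfolding free_carrier_def by blast+
  show "finite {i. x i \<noteq> 0}" by (rule x(1))
  show "x i \<in> pathalg Q" using x(2)[of i] by (cases "x i = 0") simp_all
  show "fst p = lab i" if "x i p \<noteq> 0"
    using x(2)[of i] that by (metis zero_fun_apply)
  show "x i = 0" if "i \<notin> I" using x(2)[of i] that by blast
qed

lemma free_carrierI:
  assumes "finite {i. x i \<noteq> 0}" "\<And>i. x i \<in> pathalg Q" "\<And>i p. x i p \<noteq> 0 \<Longrightarrow> fst p = lab i"
    "\<And>i. i \<notin> I \<Longrightarrow> x i = 0"
  shows "x \<in> free_carrier Q I lab"
  using assms unfolding free_carrier_def by blast

lemma add_in_free_carrier:
  assumes "x \<in> free_carrier Q I lab" "y \<in> free_carrier Q I lab"
  shows "x + y \<in> free_carrier Q I lab"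
proof (rule free_carrierI)
  show "finite {i. (x + y) i \<noteq> 0}"
    using assms by (intro finite_support_add free_carrierD(1))
  show "(x + y) i \<in> pathalg Q" for i
    using assms by (simp add: fun_apply add_in_pathalg free_carrierD(2))
  show "fst p = lab i" if "(x + y) i p \<noteq> 0" for i p
    using that free_carrierD(3)[OF assms(1), of i p] free_carrierD(3)[OF assms(2), of i p]
    by (cases "x i p = 0") (auto simp: fun_apply)
  show "(x + y) i = 0" if "i \<notin> I" for i
    using that free_carrierD(4)[OF assms(1)] free_carrierD(4)[OF assms(2)] by (simp add: plus_fun_apply)
qed

lemma minus_in_free_carrier:
  assumes "x \<in> free_carrier Q I lab"
  shows "- x \<in> free_carrier Q I lab"
  by (rule free_carrierI) (use free_carrierD[OF assms] in \<open>auto simp: minus_in_pathalg\<close>)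

lemma diff_in_free_carrier:
  "x \<in> free_carrier Q I lab \<Longrightarrow> y \<in> free_carrier Q I lab \<Longrightarrow> x - y \<in> free_carrier Q I lab"
  using add_in_free_carrier[OF _ minus_in_free_carrier, of x Q I lab y] by simp

text \<open>The left factor decides where the paths of a product start; this keeps e_v KQ closed
  under right multiplication.\<close>

lemma pmult_source:
  assumes "\<And>p. f p \<noteq> 0 \<Longrightarrow> fst p = v" and "pmult Q f g p \<noteq> 0"
  shows "fst p = v"
proof (rule ccontr)
  assume "fst p \<noteq> v"
  then have "f (fst p, as) = 0" for as using assms(1)[of "(fst p, as)"] by auto
  then have "pmult Q f g p = 0" by (cases p) (simp add: pmult_def)
  with assms(2) show False ..
qed

lemma free_act_in_free_carrier:
  assumes "is_quiver Q" "x \<in> free_carrier Q I lab" "r \<in> pathalg Q"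
  shows "free_act Q x r \<in> free_carrier Q I lab"
proof (rule free_carrierI)
  show "finite {i. free_act Q x r i \<noteq> 0}"
    by (rule finite_subset[OF _ free_carrierD(1)[OF assms(2)]]) (auto simp: free_act_def)
  show "free_act Q x r i \<in> pathalg Q" for i
    using assms by (simp add: free_act_def pmult_in_pathalg free_carrierD(2))
  show "fst p = lab i" if "free_act Q x r i p \<noteq> 0" for i p
    using pmult_source[of "x i" "lab i" Q r p] that free_carrierD(3)[OF assms(2)]
    by (auto simp: free_act_def)
  show "free_act Q x r i = 0" if "i \<notin> I" for i
    using that assms by (simp add: free_act_def free_carrierD(4))
qed

lemma free_act_add_left: "free_act Q (x + y) r = free_act Q x r + free_act Q y r"
  by (rule ext) (simp add: free_act_def pmult_add_left fun_apply)

lemma free_act_single: "free_act Q (single i y) r = single i (pmult Q y r)"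
  by (rule ext) (simp add: free_act_def single_def)

lemma free_act_zero_left [simp]: "free_act Q 0 r = 0"
  by (rule ext) (simp add: free_act_def fun_apply)

lemma free_carrier_induct [consumes 1, case_names zero single]:
  assumes "x \<in> free_carrier Q I lab" and "P 0"
    and "\<And>i y x. i \<in> I \<Longrightarrow> lab i \<in> verts Q \<Longrightarrow> y \<in> pathalg Q \<Longrightarrow> \<forall>p. y p \<noteq> 0 \<longrightarrow> fst p = lab i \<Longrightarrow>
      x \<in> free_carrier Q I lab \<Longrightarrow> P x \<Longrightarrow> P (single i y + x)"
  shows "P x"
proof -
  let ?C = "\<lambda>i y. i \<in> I \<and> y \<in> pathalg Q \<and> (\<forall>p. y p \<noteq> 0 \<longrightarrow> fst p = lab i)"
  have "finite {i. x i \<noteq> 0}" "\<forall>i. x i \<noteq> 0 \<longrightarrow> ?C i (x i)"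
    using assms(1) by (auto simp: free_carrier_def)
  then show ?thesis
  proof (induction rule: finite_support_induct[where C = ?C])
    case (single i y x)
    \<comment> \<open>An index may carry a label that is not a vertex; a nonzero \<open>y\<close>
      contains a path of Q starting at \<open>lab i\<close>, which makes this label a
      vertex.\<close>
    then obtain p where "y p \<noteq> 0" by (metis ext zero_fun_apply)
    then have "is_path Q p" "fst p = lab i" using single(2) unfolding pathalg_def by blast+
    then have "lab i \<in> verts Q" by (auto simp: is_path_def)
    moreover have "x \<in> free_carrier Q I lab" using single(3,4) unfolding free_carrier_def by blast
    ultimately show ?case using single by (intro assms(3)) auto
  qed (rule assms(2))
qed

lemma mod_hom_zero:
  assumes "mod_hom Q N actN N' actN' f" "0 \<in> N"
  shows "f 0 = 0"
proof -
  have "f (0 + 0) = f 0 + f 0" using assms unfolding mod_hom_def by blast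
  then show ?thesis by simp
qed

section \<open>From vanishing Ext to split cocycles\<close>

context arrow_functionals
begin

text \<open>On a free module the pulled back cocycle is a coboundary: the generators go to 0, the
  required identity then determines all other values, and \<open>deriv_pmult\<close> makes them
  consistent.\<close>

lemma twisted_lift:
  fixes I :: "'i set"
  assumes eps: "mod_hom Q (free_carrier Q I lab) (free_act Q) M actM eps"
  shows "\<exists>u. (\<forall>z\<in>free_carrier Q I lab. u z \<in> pathalg Q)
    \<and> (\<forall>z\<in>free_carrier Q I lab. \<forall>z'\<in>free_carrier Q I lab. u (z + z') = u z + u z')
    \<and> (\<forall>z\<in>free_carrier Q I lab. \<forall>r\<in>pathalg Q.
        u (free_act Q z r) = pmult Q (u z) r + deriv (eps z) r)"
proof -
  let ?P = "free_carrier Q I lab :: ('i \<Rightarrow> ('v, 'a) qpath \<Rightarrow> 'k) set"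
  define gen where "gen i = single i (single (lab i, []) (1::'k) :: ('v, 'a) qpath \<Rightarrow> 'k)" for i
  define u where "u z = lsum (\<lambda>i. deriv (eps (gen i))) z" for z
  have eps_in: "eps z \<in> M" if "z \<in> ?P" for z using eps that by (simp add: mod_hom_def)
  have eps_add: "eps (z + z') = eps z + eps z'" if "z \<in> ?P" "z' \<in> ?P" for z z'
    using eps that by (simp add: mod_hom_def)
  have eps_act: "eps (free_act Q z r) = actM (eps z) r" if "z \<in> ?P" "r \<in> pathalg Q" for z r
    using eps that by (simp add: mod_hom_def)
  have u_in: "u z \<in> pathalg Q" if "z \<in> ?P" for z
    unfolding u_def lsum_def
    by (rule sum_closed) (auto intro: add_in_pathalg deriv_in_pathalg free_carrierD(2)[OF that])
  have u_add: "u (z + z') = u z + u z'" if "z \<in> ?P" "z' \<in> ?P" for z z'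
    unfolding u_def
    by (rule lsum_add) (use that in \<open>auto intro: deriv_add_right free_carrierD\<close>)
  have u_single: "u (single i y) = deriv (eps (gen i)) y" for i y
    by (simp add: u_def)
  have "u (free_act Q z r) = pmult Q (u z) r + deriv (eps z) r" if z: "z \<in> ?P" and r: "r \<in> pathalg Q" for z r
    using z
  proof (induction rule: free_carrier_induct)
    case zero
    have "eps 0 = 0" by (rule mod_hom_zero[OF eps zero_in_free_carrier])
    then show ?case using r by (simp add: u_def deriv_zero_left)
  next
    case (single i y z)
    have gen: "gen i \<in> ?P"
      unfolding gen_def using single(1,2)
      by (intro single_in_free_carrier single_in_pathalg) (auto simp: single_def)
    have y: "single i y \<in> ?P" using single by (intro single_in_free_carrier)
    \<comment> \<open>Holds because \<open>y\<close> lies in e_(lab i) KQ, on which the trivial path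
      is a left identity.\<close>
    have "free_act Q (gen i) y = single i y"
      by (simp add: gen_def free_act_single pmult_vertex_left[OF single(4)])
    then have eps_y: "eps (single i y) = actM (eps (gen i)) y"
      using eps_act[OF gen single(3)] by simp
    have "u (free_act Q (single i y) r) = pmult Q (u (single i y)) r + deriv (eps (single i y)) r"
      by (simp add: free_act_single u_single eps_y deriv_pmult eps_in gen single(3) r)
    moreover have "u (free_act Q (single i y + z) r) = u (free_act Q (single i y) r) + u (free_act Q z r)"
      unfolding free_act_add_left by (intro u_add free_act_in_free_carrier quiver y single(5) r)
    moreover have "u (single i y + z) = u (single i y) + u z"
      by (rule u_add[OF y single(5)])
    moreover have "deriv (eps (single i y + z)) r = deriv (eps (single i y)) r + deriv (eps z) r"
      by (simp add: eps_add deriv_add_left eps_in y single(5) r)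
    ultimately show ?case using single(6) by (simp add: pmult_add_left)
  qed
  then show ?thesis using u_in u_add by blast
qed

lemma deriv_arrow:
  "a \<in> arrs Q \<Longrightarrow> deriv m (single (src Q a, [a]) 1) = single (tgt Q a, []) (lam a (m (src Q a)))"
  by (simp add: deriv_single)

text \<open>The map \<open>u\<close> of \<open>twisted_lift\<close> composed with d_1 is KQ-linear.
  Ext^1 = 0 yields a linear \<open>g\<close> on P_0 with the same composite, so \<open>u - g\<close>
  vanishes on the kernel of \<open>eps\<close> and descends to M.\<close>

lemma cocycle_splits:
  assumes ext: "ext_pos_vanish TYPE('i) Q M actM (pathalg Q) (pmult Q :: (('v, 'a) qpath \<Rightarrow> 'k) \<Rightarrow> _)"
  obtains psi where "\<And>m. m \<in> M \<Longrightarrow> psi m \<in> pathalg Q"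
    and "\<And>m m'. m \<in> M \<Longrightarrow> m' \<in> M \<Longrightarrow> psi (m + m') = psi m + psi m'"
    and "\<And>m a. m \<in> M \<Longrightarrow> a \<in> arrs Q \<Longrightarrow> psi (actM m (single (src Q a, [a]) 1)) =
      pmult Q (psi m) (single (src Q a, [a]) 1) + single (tgt Q a, []) (lam a (m (src Q a)))"
proof -
  obtain I :: "nat \<Rightarrow> 'i set" and lab d eps where
    eps: "mod_hom Q (free_carrier Q (I 0) (lab 0)) (free_act Q) M actM eps"
    and surj: "eps ` free_carrier Q (I 0) (lab 0) = M"
    and d: "\<forall>n. mod_hom Q (free_carrier Q (I (Suc n)) (lab (Suc n))) (free_act Q)
        (free_carrier Q (I n) (lab n)) (free_act Q) (d (Suc n))"
    and ker0: "{x \<in> free_carrier Q (I 0) (lab 0). eps x = 0} = d 1 ` free_carrier Q (I 1) (lab 1)"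
    and ker: "\<forall>n\<ge>1. {x \<in> free_carrier Q (I n) (lab n). d n x = 0} =
        d (Suc n) ` free_carrier Q (I (Suc n)) (lab (Suc n))"
    and van: "\<forall>n\<ge>1. \<forall>f. mod_hom Q (free_carrier Q (I n) (lab n)) (free_act Q) (pathalg Q) (pmult Q) f
        \<and> (\<forall>y\<in>free_carrier Q (I (Suc n)) (lab (Suc n)). f (d (Suc n) y) = 0) \<longrightarrow>
        (\<exists>g. mod_hom Q (free_carrier Q (I (n - 1)) (lab (n - 1))) (free_act Q) (pathalg Q) (pmult Q) g
          \<and> (\<forall>x\<in>free_carrier Q (I n) (lab n). f x = g (d n x)))"
    using ext unfolding ext_pos_vanish_def Let_def by (elim exE conjE) (rule that)
  let ?P = "\<lambda>n. free_carrier Q (I n) (lab n) :: ('i \<Rightarrow> ('v, 'a) qpath \<Rightarrow> 'k) set"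
  obtain u where u_in: "\<And>z. z \<in> ?P 0 \<Longrightarrow> u z \<in> pathalg Q"
    and u_add: "\<And>z z'. z \<in> ?P 0 \<Longrightarrow> z' \<in> ?P 0 \<Longrightarrow> u (z + z') = u z + u z'"
    and u_act: "\<And>z r. z \<in> ?P 0 \<Longrightarrow> r \<in> pathalg Q \<Longrightarrow>
        u (free_act Q z r) = pmult Q (u z) r + deriv (eps z) r"
    using twisted_lift[OF eps] by blast
  have u0: "u 0 = 0" using u_add[of 0 0] by (simp add: zero_in_free_carrier)
  have d1: "mod_hom Q (?P 1) (free_act Q) (?P 0) (free_act Q) (d 1)" using d[rule_format, of 0] by simp
  have eps_d: "eps (d 1 x) = 0" if "x \<in> ?P 1" for x using ker0 that by blast
  have d1_in: "d 1 x \<in> ?P 0" if "x \<in> ?P 1" for x using ker0 that by blast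
  have hom: "mod_hom Q (?P 1) (free_act Q) (pathalg Q) (pmult Q) (\<lambda>x. u (d 1 x))"
    unfolding mod_hom_def
  proof (intro conjI ballI)
    fix x y r assume x: "x \<in> ?P 1"
    show "u (d 1 x) \<in> pathalg Q" by (rule u_in[OF d1_in[OF x]])
    show "u (d 1 (x + y)) = u (d 1 x) + u (d 1 y)" if "y \<in> ?P 1"
      using d1 x that by (simp add: mod_hom_def u_add)
    \<comment> \<open>The derivation term disappears because eps d_1 = 0.\<close>
    show "u (d 1 (free_act Q x r)) = pmult Q (u (d 1 x)) r" if "r \<in> pathalg Q"
      using d1 x that eps_d[OF x] by (simp add: mod_hom_def u_act deriv_zero_left)
  qed
  \<comment> \<open>The cocycle condition, from d_1 d_2 = 0.\<close>
  have "u (d 1 (d (Suc 1) y)) = 0" if "y \<in> ?P (Suc 1)" for y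
  proof -
    have "d 1 (d (Suc 1) y) = 0" using ker[rule_format, OF order_refl] that by blast
    then show ?thesis using u0 by simp
  qed
  then obtain g where g: "mod_hom Q (?P 0) (free_act Q) (pathalg Q) (pmult Q) g"
    and ug: "\<And>x. x \<in> ?P 1 \<Longrightarrow> u (d 1 x) = g (d 1 x)"
    using van[rule_format, of 1 "\<lambda>x. u (d 1 x)"] hom by auto
  have g_add: "g (z + z') = g z + g z'" if "z \<in> ?P 0" "z' \<in> ?P 0" for z z'
    using g that by (simp add: mod_hom_def)
  have g_in: "g z \<in> pathalg Q" if "z \<in> ?P 0" for z using g that by (simp add: mod_hom_def)
  have g_act: "g (free_act Q z r) = pmult Q (g z) r" if "z \<in> ?P 0" "r \<in> pathalg Q" for z r
    using g that by (simp add: mod_hom_def)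
  \<comment> \<open>An arbitrary set-theoretic section of \<open>eps\<close>; by
    \<open>psi_eps\<close> the choice does not affect \<open>psi\<close>.\<close>
  define lift where "lift = inv_into (?P 0) eps"
  define psi where "psi m = u (lift m) - g (lift m)" for m
  have lift: "lift m \<in> ?P 0 \<and> eps (lift m) = m" if "m \<in> M" for m
    unfolding lift_def using inv_into_into[of m eps "?P 0"] f_inv_into_f[of m eps "?P 0"] surj that by simp
  have psi_eps: "psi (eps z) = u z - g z" if z: "z \<in> ?P 0" for z
  proof -
    let ?y = "lift (eps z)"
    have epsz: "eps z \<in> M" using eps z by (simp add: mod_hom_def)
    have y: "?y \<in> ?P 0" "eps ?y = eps z" using lift[OF epsz] by auto
    \<comment> \<open>Two preimages differ by an element of the kernel of \<open>eps\<close>, the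
      image of d_1, where \<open>u\<close> and \<open>g\<close> agree.\<close>
    have k: "?y - z \<in> ?P 0" by (rule diff_in_free_carrier[OF y(1) z])
    have "eps (?y - z + z) = eps (?y - z) + eps z"
      using eps k z unfolding mod_hom_def by blast
    then have "eps ?y = eps (?y - z) + eps z" by simp
    then have "eps (?y - z) = 0" using y(2) by simp
    then have "?y - z \<in> {x \<in> ?P 0. eps x = 0}" using k by simp
    then obtain x where "x \<in> ?P 1" "?y - z = d 1 x" unfolding ker0 by (rule imageE)
    then have "u (?y - z) = g (?y - z)" using ug by simp
    moreover have "u ?y = u (?y - z) + u z" "g ?y = g (?y - z) + g z"
      using u_add[OF k z] g_add[OF k z] by auto
    ultimately show ?thesis by (simp add: psi_def)
  qed
  show thesis
  proof
    fix m assume m: "m \<in> M"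
    let ?z = "lift m"
    have z: "?z \<in> ?P 0" "eps ?z = m" using lift[OF m] by auto
    have "u ?z + - g ?z \<in> pathalg Q"
      by (intro add_in_pathalg minus_in_pathalg u_in g_in z(1))
    then show "psi m \<in> pathalg Q" by (simp add: psi_def)
    show "psi (m + m') = psi m + psi m'" if m': "m' \<in> M" for m'
    proof -
      let ?z' = "lift m'"
      have z': "?z' \<in> ?P 0" "eps ?z' = m'" using lift[OF m'] by auto
      have "eps (?z + ?z') = m + m'" using eps z z' by (simp add: mod_hom_def)
      then show ?thesis
        using psi_eps[OF add_in_free_carrier[OF z(1) z'(1)]]
        by (simp add: psi_def u_add g_add z(1) z'(1))
    qed
    show "psi (actM m (single (src Q a, [a]) 1)) =
        pmult Q (psi m) (single (src Q a, [a]) 1) + single (tgt Q a, []) (lam a (m (src Q a)))"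
      if a: "a \<in> arrs Q" for a
    proof -
      let ?r = "single (src Q a, [a]) (1::'k)"
      have r: "?r \<in> pathalg Q"
        using a by (intro single_in_pathalg) (simp add: is_path_Cons[OF quiver] tgt_in_verts)
      have "eps (free_act Q ?z ?r) = actM m ?r" using eps z r by (simp add: mod_hom_def)
      then have "psi (actM m ?r) = u (free_act Q ?z ?r) - g (free_act Q ?z ?r)"
        using psi_eps[OF free_act_in_free_carrier[OF quiver z(1) r]] by simp
      also have "\<dots> = pmult Q (psi m) ?r + deriv m ?r"
        by (simp add: u_act g_act z r psi_def pmult_diff_left)
      finally show ?thesis using a by (simp add: deriv_arrow)
    qed
  qed
qed

end


section \<open>Representations with split cocycles\<close>

context quiver_rep
begin

lemma XA_diff: "a \<in> arrs Q \<Longrightarrow> x \<in> X (src Q a) \<Longrightarrow> y \<in> X (src Q a) \<Longrightarrow>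
    XA a (x - y) = XA a x - XA a y"
  using XA_add[of a x "- y"] by (simp add: XA_minus minus_in_X src_in_verts)

lemma XA_lincomb:
  assumes "a \<in> arrs Q" "\<And>i. i \<in> T \<Longrightarrow> b i \<in> X (src Q a)"
  shows "XA a (\<Sum>i\<in>T. u i *s b i) = (\<Sum>i\<in>T. u i *s XA a (b i))"
proof -
  have "XA a (\<Sum>i\<in>T. u i *s b i) = (\<Sum>i\<in>T. XA a (u i *s b i))"
    by (rule additive_on_sum[where E = "X (src Q a)"])
      (use assms in \<open>auto intro: zero_in_X add_in_X scale_in_X src_in_verts XA_zero XA_add\<close>)
  then show ?thesis using assms by (simp add: XA_scale)
qed

text \<open>The coordinate at \<open>y\<close> in a basis of the whole space that extends
  \<open>{y}\<close>.\<close>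

lemma functional_exists:
  assumes "y \<noteq> 0"
  shows "\<exists>l. (\<forall>x x'. l (x + x') = l x + l x') \<and> (\<forall>c x. l (c *s x) = c * l x) \<and> l y = (1::'k)"
proof -
  let ?B = "extend_basis {y}"
  have ind: "independent {y}" using assms by simp
  have B: "independent ?B" "span ?B = UNIV" "y \<in> ?B"
    using independent_extend_basis[OF ind] span_extend_basis[OF ind] extend_basis_superset[OF ind] by auto
  show ?thesis
    by (rule exI[of _ "\<lambda>x. representation ?B x y"])
      (simp add: B representation_add representation_scale representation_basis)
qed

lemma basis_of_X:
  assumes "v \<in> verts Q"
  obtains B where "finite B" "B \<subseteq> X v" "independent B" "X v \<subseteq> span B" "card B = dim (X v)"
proof -
  obtain B where B: "B \<subseteq> X v" "independent B" "X v \<subseteq> span B" "card B = dim (X v)"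
    by (rule basis_exists)
  obtain C where "finite C" "X v \<subseteq> span C"
    using rep assms unfolding fd_representation_def by blast
  then have "finite B" using independent_span_bound[of C B] B by auto
  then show thesis using that B by blast
qed

lemma card_le_dim_X:
  assumes "v \<in> verts Q" "B \<subseteq> X v" "independent B"
  shows "finite B" "card B \<le> dim (X v)"
proof -
  obtain C where "finite C" "X v \<subseteq> span C" "card C = dim (X v)"
    by (rule basis_of_X[OF assms(1)])
  then show "finite B" "card B \<le> dim (X v)"
    using independent_span_bound[of C B] assms by auto
qed

end

text \<open>Collects what the later arguments take from Ext and from the closures of finite vertex
  sets. Here \<open>psi v x\<close> is the value of the splitting map at x placed in component
  v.\<close>

locale split_rep = quiver_rep scale Q X XA
  for scale :: "'k::field \<Rightarrow> 'x::ab_group_add \<Rightarrow> 'x" (infixr \<open>*s\<close> 75)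
  and Q :: "('v, 'a) quiver" and X :: "'v \<Rightarrow> 'x set" and XA :: "'a \<Rightarrow> 'x \<Rightarrow> 'x" +
  assumes cocycle_split: "\<And>lam. (\<And>a x y. lam a (x + y) = lam a x + lam a y) \<Longrightarrow>
      (\<And>a c x. lam a (c *s x) = c * lam a x) \<Longrightarrow>
      \<exists>psi :: 'v \<Rightarrow> 'x \<Rightarrow> ('v, 'a) qpath \<Rightarrow> 'k.
        (\<forall>v\<in>verts Q. \<forall>x\<in>X v. psi v x \<in> pathalg Q)
        \<and> (\<forall>v\<in>verts Q. \<forall>x\<in>X v. \<forall>y\<in>X v. psi v (x + y) = psi v x + psi v y)
        \<and> (\<forall>a\<in>arrs Q. \<forall>x\<in>X (src Q a). psi (tgt Q a) (XA a x) =
              pmult Q (psi (src Q a) x) (single (src Q a, [a]) 1) + single (tgt Q a, []) (lam a x))"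
    and no_cycle: "\<And>p. is_path Q p \<Longrightarrow> snd p \<noteq> [] \<Longrightarrow> path_tgt Q p \<noteq> fst p"
begin

(* The coefficient of the trivial path at v vanishes on every product with an arrow, so a
   relation among the images of the arrows ending in v would be seen by a split cocycle. *)
lemma incoming_sum_inj:
  assumes A: "finite A" "\<And>a. a \<in> A \<Longrightarrow> a \<in> arrs Q \<and> tgt Q a = v"
    and x: "\<And>a. a \<in> A \<Longrightarrow> x a \<in> X (src Q a)"
    and sum: "(\<Sum>a\<in>A. XA a (x a)) = 0" and b: "b \<in> A"
  shows "x b = 0"
proof (rule ccontr)
  assume "x b \<noteq> 0"
  then obtain l where l: "\<forall>x x'. l (x + x') = l x + l x'" "\<forall>c x. l (c *s x) = c * l x" "l (x b) = (1::'k)"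
    using functional_exists by blast
  define lam where "lam a = (if a = b then l else (\<lambda>_. 0))" for a
  have v: "v \<in> verts Q" using A(2)[OF b] tgt_in_verts by blast
  have "lam a (x + y) = lam a x + lam a y" "lam a (c *s x) = c * lam a x" for a x y c
    using l by (simp_all add: lam_def)
  then obtain psi where psi_add: "\<And>x y. x \<in> X v \<Longrightarrow> y \<in> X v \<Longrightarrow> psi v (x + y) = psi v x + psi v y"
    and psi_arr: "\<And>a x. a \<in> arrs Q \<Longrightarrow> x \<in> X (src Q a) \<Longrightarrow> psi (tgt Q a) (XA a x) =
              pmult Q (psi (src Q a) x) (single (src Q a, [a]) 1) + single (tgt Q a, []) (lam a x)"
    using cocycle_split[of lam] v by blast
  have psi0: "psi v 0 = 0" using psi_add[of 0 0] zero_in_X[OF v] by simp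
  have "psi v (\<Sum>a\<in>A. XA a (x a)) = (\<Sum>a\<in>A. psi v (XA a (x a)))"
    using A x XA_in_X
    by (intro additive_on_sum[where E = "X v"] zero_in_X add_in_X v psi0 psi_add) metis+
  then have "0 = (\<Sum>a\<in>A. psi v (XA a (x a)) (v, []))"
    using sum psi0 sum_fun_apply[of "\<lambda>a. psi v (XA a (x a))" A "(v, [])"] by (simp add: zero_fun_apply)
  also have "\<dots> = (\<Sum>a\<in>A. if a = b then 1 else 0)"
  proof (rule sum.cong[OF refl])
    fix a assume a: "a \<in> A"
    then have "psi v (XA a (x a)) (v, []) = lam a (x a)"
      using psi_arr[of a "x a"] A(2)[OF a] x[OF a] by (simp add: plus_fun_apply pmult_arrow_Nil)
    then show "psi v (XA a (x a)) (v, []) = (if a = b then 1 else 0)" by (simp add: lam_def l)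
  qed
  also have "\<dots> = 1" using A(1) b by simp
  finally show False by simp
qed

lemma XA_inj:
  assumes "a \<in> arrs Q" "x \<in> X (src Q a)" "y \<in> X (src Q a)" "XA a x = XA a y"
  shows "x = y"
  using incoming_sum_inj[of "{a}" "tgt Q a" "\<lambda>_. x - y" a] assms
  by (simp add: XA_diff diff_in_X src_in_verts)

text \<open>If the arrows differed, \<open>x\<close> and \<open>- y\<close> would form a nontrivial
  relation among incoming arrows. This keeps prescriptions along different arrows from
  colliding.\<close>

lemma incoming_disjoint:
  assumes "a \<in> arrs Q" "b \<in> arrs Q" "tgt Q a = tgt Q b" "x \<in> X (src Q a)" "y \<in> X (src Q b)"
    and "XA a x = XA b y" "x \<noteq> 0"
  shows "a = b"
proof (rule ccontr)
  assume "a \<noteq> b"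
  let ?x = "\<lambda>c. if c = a then x else - y"
  have "?x a = 0"
  proof (rule incoming_sum_inj[of "{a, b}" "tgt Q a" ?x a])
    show "?x c \<in> X (src Q c)" if "c \<in> {a, b}" for c
      using that assms by (auto simp: minus_in_X src_in_verts)
    show "(\<Sum>c\<in>{a, b}. XA c (?x c)) = 0"
      using \<open>a \<noteq> b\<close> assms by (auto simp: XA_minus)
  qed (use assms in auto)
  then show False using \<open>x \<noteq> 0\<close> by simp
qed

text \<open>By \<open>incoming_sum_inj\<close> the spaces X_(s a) embed jointly as a direct sum. A
  linear relation is sorted by arrows; each part comes from the zero vector at its source, and there
  independence of \<open>B a\<close> applies.\<close>

lemma incoming_images_independent:
  assumes A: "\<And>a. a \<in> A \<Longrightarrow> a \<in> arrs Q \<and> tgt Q a = v"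
    and B: "\<And>a. a \<in> A \<Longrightarrow> B a \<subseteq> X (src Q a)" "\<And>a. a \<in> A \<Longrightarrow> independent (B a)"
  shows "independent (\<Union>a\<in>A. XA a ` B a)"
  unfolding independent_explicit_module
proof (intro allI impI)
  fix T u t0
  assume T: "finite T" "T \<subseteq> (\<Union>a\<in>A. XA a ` B a)" and sum: "(\<Sum>t\<in>T. u t *s t) = 0" and t0: "t0 \<in> T"
  have "\<forall>t\<in>T. \<exists>a b. a \<in> A \<and> b \<in> B a \<and> t = XA a b" using T(2) by blast
  then obtain al be where ab: "\<And>t. t \<in> T \<Longrightarrow> al t \<in> A \<and> be t \<in> B (al t) \<and> t = XA (al t) (be t)"
    by metis
  \<comment> \<open>\<open>al\<close> and \<open>be\<close> choose an arrow and a preimage for each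
    vector; the fibres of \<open>al\<close> sort the relation, and only finitely many arrows
    occur.\<close>
  define F where "F a = {t \<in> T. al t = a}" for a
  define x where "x a = (\<Sum>t\<in>F a. u t *s be t)" for a
  have be_X: "be t \<in> X (src Q a)" if "a \<in> A" "t \<in> F a" for a t
    using ab[of t] that B(1) unfolding F_def by blast
  have "(\<Sum>t\<in>T. u t *s t) = (\<Sum>a\<in>al ` T. \<Sum>t\<in>F a. u t *s t)"
    using sum.image_gen[OF T(1), of "\<lambda>t. u t *s t" al] by (simp add: F_def)
  also have "\<dots> = (\<Sum>a\<in>al ` T. XA a (x a))"
  proof (rule sum.cong[OF refl])
    fix a assume "a \<in> al ` T"
    then have a: "a \<in> A" using ab by blast
    have "XA a (x a) = (\<Sum>t\<in>F a. u t *s XA a (be t))"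
      unfolding x_def using A[OF a] be_X[OF a] by (intro XA_lincomb) auto
    also have "\<dots> = (\<Sum>t\<in>F a. u t *s t)"
      by (rule sum.cong[OF refl]) (use ab in \<open>auto simp: F_def\<close>)
    finally show "(\<Sum>t\<in>F a. u t *s t) = XA a (x a)" ..
  qed
  finally have zero: "(\<Sum>a\<in>al ` T. XA a (x a)) = 0" using sum by simp
  let ?a = "al t0"
  have a: "?a \<in> A" using ab t0 by blast
  have x_in: "x a \<in> X (src Q a)" if "a \<in> al ` T" for a
  proof -
    have "a \<in> A" using that ab by blast
    then show ?thesis unfolding x_def using A[of a] be_X[of a]
      by (intro sum_closed zero_in_X add_in_X scale_in_X) (auto simp: src_in_verts)
  qed
  have "x ?a = 0"
    by (rule incoming_sum_inj[of "al ` T" v x]) (use T(1) A ab x_in zero t0 in auto)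
  \<comment> \<open>Within a fibre \<open>be t\<close> determines t, so the coefficients can be
    indexed by preimages instead.\<close>
  have inj: "inj_on be (F ?a)"
    by (rule inj_onI) (metis (mono_tags, lifting) F_def ab mem_Collect_eq)
  have "(\<Sum>b\<in>be ` F ?a. u (XA ?a b) *s b) = (\<Sum>t\<in>F ?a. u (XA ?a (be t)) *s be t)"
    using sum.reindex[OF inj] by simp
  also have "\<dots> = x ?a"
  proof -
    have "XA ?a (be t) = t" if "t \<in> F ?a" for t
      using that ab unfolding F_def by (metis (mono_tags, lifting) mem_Collect_eq)
    then show ?thesis unfolding x_def by (intro sum.cong) simp_all
  qed
  also have "\<dots> = 0" by fact
  finally have lin: "(\<Sum>b\<in>be ` F ?a. u (XA ?a b) *s b) = 0" .
  have "be ` F ?a \<subseteq> B ?a"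
    by (rule image_subsetI) (metis (mono_tags, lifting) F_def ab mem_Collect_eq)
  moreover have "finite (be ` F ?a)" using T(1) by (simp add: F_def)
  moreover have "be t0 \<in> be ` F ?a" using t0 by (auto simp: F_def)
  ultimately have "u (XA ?a (be t0)) = 0"
    using independentD[OF B(2)[OF a] _ _ lin] by blast
  then show "u t0 = 0" using ab[OF t0] by simp
qed

text \<open>The image of a basis is independent and has the same size, which bounds the dimension.
  If both dimensions agree, no further vector is independent of that image.\<close>

lemma dim_src_le: "a \<in> arrs Q \<Longrightarrow> dim (X (src Q a)) \<le> dim (X (tgt Q a))"
  and XA_surj: "a \<in> arrs Q \<Longrightarrow> dim (X (src Q a)) = dim (X (tgt Q a)) \<Longrightarrow>
    y \<in> X (tgt Q a) \<Longrightarrow> \<exists>x\<in>X (src Q a). XA a x = y"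
proof -
  assume a: "a \<in> arrs Q"
  note v = src_in_verts[OF a] tgt_in_verts[OF a]
  obtain B where B: "finite B" "B \<subseteq> X (src Q a)" "independent B" "X (src Q a) \<subseteq> span B"
    "card B = dim (X (src Q a))"
    by (rule basis_of_X[OF v(1)])
  have ind: "independent (XA a ` B)"
    using incoming_images_independent[of "{a}" "tgt Q a" "\<lambda>_. B"] a B by simp
  have sub: "XA a ` B \<subseteq> X (tgt Q a)" using B(2) XA_in_X[OF a] by blast
  have "inj_on (XA a) B" by (rule inj_onI) (use XA_inj[OF a] B(2) in blast)
  then have card: "card (XA a ` B) = dim (X (src Q a))" using B(5) by (simp add: card_image)
  show "dim (X (src Q a)) \<le> dim (X (tgt Q a))"
    using card_le_dim_X[OF v(2) sub ind] card by simp
  assume eq: "dim (X (src Q a)) = dim (X (tgt Q a))" and y: "y \<in> X (tgt Q a)"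
  have "y \<in> span (XA a ` B)"
  proof (rule ccontr)
    assume n: "y \<notin> span (XA a ` B)"
    then have "independent (insert y (XA a ` B))" by (rule independent_insertI[OF _ ind])
    moreover have "y \<notin> XA a ` B" using n span_base by blast
    ultimately show False
      using card_le_dim_X[OF v(2), of "insert y (XA a ` B)"] sub y card eq B(1) by simp
  qed
  also have "span (XA a ` B) \<subseteq> XA a ` X (src Q a)"
  proof (rule span_minimal)
    show "XA a ` B \<subseteq> XA a ` X (src Q a)" using B(2) by blast
    show "subspace (XA a ` X (src Q a))"
    proof (rule subspaceI)
      show "0 \<in> XA a ` X (src Q a)" using XA_zero[OF a] zero_in_X[OF v(1)] by force
      show "x + y \<in> XA a ` X (src Q a)" if "x \<in> XA a ` X (src Q a)" "y \<in> XA a ` X (src Q a)" for x y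
        using that XA_add[OF a] add_in_X[OF v(1)] by (auto simp flip: XA_add[OF a])
      show "c *s x \<in> XA a ` X (src Q a)" if "x \<in> XA a ` X (src Q a)" for c x
        using that scale_in_X[OF v(1)] by (auto simp flip: XA_scale[OF a])
    qed
  qed
  finally show "\<exists>x\<in>X (src Q a). XA a x = y" by blast
qed

section \<open>Well-foundedness of the supported arrows\<close>

text \<open>Sources lie below targets, so well-foundedness excludes infinite backward chains. The
  condition on the source space matters: Q itself may contain such chains.\<close>

definition supported_arrows :: "('v \<times> 'v) set" where
  "supported_arrows = {(src Q a, tgt Q a) | a. a \<in> arrs Q \<and> X (src Q a) \<noteq> {0}}"

text \<open>Each unrolling of psi(y_n) = psi(y_(n+1)) a_n + e_(w n) puts a longer path into
  psi(y_0), against finite support.\<close>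

lemma no_coherent_chain:
  assumes al: "\<And>n. al n \<in> arrs Q" "\<And>n. src Q (al n) = w (Suc n)" "\<And>n. tgt Q (al n) = w n"
    and y: "\<And>n. y n \<in> X (w n)" "\<And>n. y n \<noteq> 0" "\<And>n. XA (al n) (y (Suc n)) = y n"
  shows False
proof -
  \<comment> \<open>The arrows a_(n+k-1), ..., a_n in this order, leading from w (n+k) to w
    n.\<close>
  define path where "path n k = map al (rev [n..<n + k])" for n k
  have path: "is_path Q (w (n + k), path n k) \<and> path_tgt Q (w (n + k), path n k) = w n" for n k
  proof (induction k)
    case 0
    then show ?case using tgt_in_verts[OF al(1), of n] al(3) by (simp add: path_def)
  next
    case (Suc k)
    then show ?case by (simp add: path_def is_path_Cons[OF quiver] al)
  qed
  \<comment> \<open>A repeated vertex would close a cycle. Distinct vertices make the arrows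
    distinct, so that \<open>inv al\<close> recovers the index in \<open>lam\<close>.\<close>
  have "w (n + Suc k) \<noteq> w n" for n k
    using no_cycle[of "(w (n + Suc k), path n (Suc k))"] path[of n "Suc k"] by (simp add: path_def)
  then have w_inj: "inj w"
    by (intro linorder_injI) (metis less_iff_Suc_add add_Suc_right)
  have al_inj: "inj al" by (rule injI) (metis al(3) w_inj injD)
  obtain l where l: "\<And>y x x'. y \<noteq> 0 \<Longrightarrow> l y (x + x') = l y x + l y x'"
    "\<And>y c x. y \<noteq> 0 \<Longrightarrow> l y (c *s x) = c * l y x" "\<And>y. y \<noteq> 0 \<Longrightarrow> l y y = (1::'k)"
    using functional_exists by metis
  \<comment> \<open>Normalised to take the value 1 at y_(n+1) on the arrow a_n, and zero off the
    chain.\<close>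
  define lam where "lam a x = (if a \<in> range al then l (y (Suc (inv al a))) x else 0)" for a x
  have lam_al: "lam (al n) (y (Suc n)) = 1" for n
    using al_inj y(2) by (simp add: lam_def l)
  have "lam a (x + x') = lam a x + lam a x'" "lam a (c *s x) = c * lam a x" for a x x' c
    using y(2) by (simp_all add: lam_def l)
  then have "\<exists>psi :: 'v \<Rightarrow> 'x \<Rightarrow> ('v, 'a) qpath \<Rightarrow> 'k.
        (\<forall>v\<in>verts Q. \<forall>x\<in>X v. psi v x \<in> pathalg Q)
        \<and> (\<forall>v\<in>verts Q. \<forall>x\<in>X v. \<forall>y\<in>X v. psi v (x + y) = psi v x + psi v y)
        \<and> (\<forall>a\<in>arrs Q. \<forall>x\<in>X (src Q a). psi (tgt Q a) (XA a x) =
              pmult Q (psi (src Q a) x) (single (src Q a, [a]) 1) + single (tgt Q a, []) (lam a x))"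
    by (rule cocycle_split)
  then obtain psi where psi_in: "\<And>v x. v \<in> verts Q \<Longrightarrow> x \<in> X v \<Longrightarrow> psi v x \<in> pathalg Q"
    and psi_arr: "\<And>a x. a \<in> arrs Q \<Longrightarrow> x \<in> X (src Q a) \<Longrightarrow> psi (tgt Q a) (XA a x) =
              pmult Q (psi (src Q a) x) (single (src Q a, [a]) 1) + single (tgt Q a, []) (lam a x)"
    by blast
  have psi: "psi (w n) (y n) =
      pmult Q (psi (w (Suc n)) (y (Suc n))) (single (w (Suc n), [al n]) 1) + single (w n, []) 1" for n
    using psi_arr[of "al n" "y (Suc n)"] al y lam_al by simp
  have coeff: "psi (w n) (y n) (w (n + k), path n k) = 1" for n k
  proof (induction k arbitrary: n)
    case 0
    then show ?case by (simp add: psi[of n] plus_fun_apply path_def pmult_arrow_Nil)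
  next
    case (Suc k)
    \<comment> \<open>The recursion for \<open>psi\<close> splits off the last arrow
      \<open>al n\<close>, while the induction for \<open>path\<close> above splits off the
      first.\<close>
    have eq: "path n (Suc k) = path (Suc n) k @ [al n]"
      unfolding path_def by (simp add: upt_conv_Cons del: upt_Suc)
    have "psi (w n) (y n) (w (Suc n + k), path (Suc n) k @ [al n]) =
        psi (w (Suc n)) (y (Suc n)) (w (Suc n + k), path (Suc n) k)"
      using pmult_arrow_snoc[of Q "psi (w (Suc n)) (y (Suc n))" "w (Suc n + k)" "path (Suc n) k" "al n"]
        path[of "Suc n" k] by (simp add: psi[of n] plus_fun_apply)
    then show ?case using Suc[of "Suc n"] eq by simp
  qed
  \<comment> \<open>The paths for different k start at different vertices.\<close>
  have "inj (\<lambda>k. (w k, path 0 k))" using w_inj by (auto simp: inj_def)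
  then have "infinite (range (\<lambda>k. (w k, path 0 k)))" by (rule range_inj_infinite)
  moreover have "range (\<lambda>k. (w k, path 0 k)) \<subseteq> {p. psi (w 0) (y 0) p \<noteq> 0}"
    using coeff[of 0] by auto
  moreover have "finite {p. psi (w 0) (y 0) p \<noteq> 0}"
    using tgt_in_verts[OF al(1), of 0] al(3) y(1) by (intro finite_support_pathalg[of _ Q] psi_in) auto
  ultimately show False using finite_subset by blast
qed

lemma wf_supported_arrows: "wf supported_arrows"
proof (rule ccontr)
  assume "\<not> wf supported_arrows"
  then obtain v where "\<And>n. (v (Suc n), v n) \<in> supported_arrows"
    unfolding wf_iff_no_infinite_down_chain by blast
  then have "\<exists>a. a \<in> arrs Q \<and> src Q a = v (Suc n) \<and> tgt Q a = v n \<and> X (v (Suc n)) \<noteq> {0}" for n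
    using mem_Collect_eq unfolding supported_arrows_def by (smt (verit) prod.inject)
  then obtain al where al: "\<And>n. al n \<in> arrs Q" "\<And>n. src Q (al n) = v (Suc n)" "\<And>n. tgt Q (al n) = v n"
    and nz: "\<And>n. X (v (Suc n)) \<noteq> {0}"
    by metis
  have "dim (X (v (Suc n))) \<le> dim (X (v n))" for n
    using dim_src_le[OF al(1)[of n]] al by simp
  then have dec: "antimono (\<lambda>n. dim (X (v n)))" by (simp add: antimono_iff_le_Suc)
  \<comment> \<open>Dimensions do not grow backwards along the chain, so from an index of least
    dimension on they are constant.\<close>
  obtain N where N: "\<And>n. dim (X (v N)) \<le> dim (X (v n))"
    using ex_has_least_nat[of "\<lambda>_. True" 0 "\<lambda>n. dim (X (v n))"] by blast
  \<comment> \<open>The chain restarts at \<open>Suc N\<close>, since a nonzero space is known only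
    at sources of its arrows, which excludes index 0.\<close>
  define w where "w n = v (Suc N + n)" for n
  define be where "be n = al (Suc N + n)" for n
  have be: "be n \<in> arrs Q" "src Q (be n) = w (Suc n)" "tgt Q (be n) = w n" for n
    using al by (simp_all add: be_def w_def)
  have "dim (X (w n)) = dim (X (v N))" for n
    using N[of "Suc N + n"] antimonoD[OF dec, of N "Suc N + n"] by (simp add: w_def)
  then have surj: "\<exists>x\<in>X (w (Suc n)). XA (be n) x = y" if "y \<in> X (w n)" for n y
    using XA_surj[OF be(1)[of n]] be that by simp
  have "w 0 \<in> verts Q" using tgt_in_verts[OF be(1)[of 0]] be by simp
  then obtain y0 where y0: "y0 \<in> X (w 0)" "y0 \<noteq> 0" using nz[of N] zero_in_X[of "w 0"] by (auto simp: w_def)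
  \<comment> \<open>Surjectivity supplies preimages one after another; a preimage of a nonzero
    vector is nonzero.\<close>
  have "\<exists>y. \<forall>n. (y n \<in> X (w n) \<and> y n \<noteq> 0) \<and> XA (be n) (y (Suc n)) = y n"
  proof (rule dependent_nat_choice)
    show "\<exists>y. y \<in> X (w 0) \<and> y \<noteq> 0" using y0 by blast
    show "\<exists>x. (x \<in> X (w (Suc n)) \<and> x \<noteq> 0) \<and> XA (be n) x = y" if "y \<in> X (w n) \<and> y \<noteq> 0" for y n
      using surj[of y n] that XA_zero[OF be(1), of n] by metis
  qed
  then show False using no_coherent_chain[of be w] be by metis
qed

end


section \<open>Sections of epimorphisms\<close>

locale epi_onto_rep = split_rep scale Q X XA
  for scale :: "'k::field \<Rightarrow> 'x::ab_group_add \<Rightarrow> 'x" (infixr \<open>*s\<close> 75)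
  and Q :: "('v, 'a) quiver" and X :: "'v \<Rightarrow> 'x set" and XA :: "'a \<Rightarrow> 'x \<Rightarrow> 'x" +
  fixes N :: "'e::ab_group_add set" and act :: "'e \<Rightarrow> (('v, 'a) qpath \<Rightarrow> 'k) \<Rightarrow> 'e"
    and f :: "'e \<Rightarrow> 'v \<Rightarrow> 'x"
  assumes module_N: "rmodule Q N act" and hom: "mod_hom Q N act M actM f" and surj: "f ` N = M"
begin

section \<open>Vertex components of the module above G(X)\<close>

lemma N_zero: "0 \<in> N"
  and N_add: "z \<in> N \<Longrightarrow> z' \<in> N \<Longrightarrow> z + z' \<in> N"
  and act_in: "z \<in> N \<Longrightarrow> r \<in> pathalg Q \<Longrightarrow> act z r \<in> N"
  and act_add_left: "z \<in> N \<Longrightarrow> z' \<in> N \<Longrightarrow> r \<in> pathalg Q \<Longrightarrow> act (z + z') r = act z r + act z' r"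
  and act_add_right: "z \<in> N \<Longrightarrow> r \<in> pathalg Q \<Longrightarrow> r' \<in> pathalg Q \<Longrightarrow>
    act z (r + r') = act z r + act z r'"
  and act_act: "z \<in> N \<Longrightarrow> r \<in> pathalg Q \<Longrightarrow> r' \<in> pathalg Q \<Longrightarrow>
    act (act z r) r' = act z (pmult Q r r')"
  using module_N by (simp_all add: rmodule_def)

lemma f_add: "z \<in> N \<Longrightarrow> z' \<in> N \<Longrightarrow> f (z + z') = f z + f z'"
  and f_act: "z \<in> N \<Longrightarrow> r \<in> pathalg Q \<Longrightarrow> f (act z r) = actM (f z) r"
  using hom by (simp_all add: mod_hom_def)

lemma f_zero: "f 0 = 0"
  by (rule mod_hom_zero[OF hom N_zero])

lemma act_zero_left: "r \<in> pathalg Q \<Longrightarrow> act 0 r = 0"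
  using act_add_left[of 0 0 r] by (simp add: N_zero)

lemma act_zero_right: "z \<in> N \<Longrightarrow> act z 0 = 0"
  using act_add_right[of z 0 0] by simp

lemma vertex_in_pathalg: "v \<in> verts Q \<Longrightarrow> single (v, []) c \<in> pathalg Q"
  by (simp add: single_in_pathalg)

lemma arrow_in_pathalg: "a \<in> arrs Q \<Longrightarrow> single (src Q a, [a]) c \<in> pathalg Q"
  by (simp add: single_in_pathalg is_path_Cons[OF quiver] tgt_in_verts)

text \<open>The component N e_v, on which a scalar c acts as c e_v. Modules need not be unital, so N
  may exceed the sum of these components.\<close>

definition N_at :: "'v \<Rightarrow> 'e set" where
  "N_at v = {z \<in> N. act z (single (v, []) 1) = z}"

lemma N_at_zero: "v \<in> verts Q \<Longrightarrow> 0 \<in> N_at v"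
  by (simp add: N_at_def N_zero act_zero_left vertex_in_pathalg)

lemma N_at_add: "v \<in> verts Q \<Longrightarrow> z \<in> N_at v \<Longrightarrow> z' \<in> N_at v \<Longrightarrow> z + z' \<in> N_at v"
  by (simp add: N_at_def N_add act_add_left vertex_in_pathalg)

lemma N_atD: "z \<in> N_at v \<Longrightarrow> z \<in> N"
  by (simp add: N_at_def)

lemma act_path_in_N_at:
  assumes "z \<in> N" "is_path Q (v, as)"
  shows "act z (single (v, as) c) \<in> N_at (path_tgt Q (v, as))"
  using assms path_tgt_in_verts[OF quiver assms(2)]
  by (simp add: N_at_def act_in act_act single_in_pathalg pmult_single)

lemma act_path_mismatch:
  assumes "z \<in> N_at v" "v \<in> verts Q" "is_path Q (w, as)" "w \<noteq> v"
  shows "act z (single (w, as) c) = 0"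
proof -
  have z: "z \<in> N" "act z (single (v, []) 1) = z" using assms(1) by (simp_all add: N_at_def)
  have "act (act z (single (v, []) 1)) (single (w, as) c) = 0"
    using assms z(1) by (simp add: act_act single_in_pathalg pmult_single act_zero_right)
  then show ?thesis by (simp add: z(2))
qed

text \<open>The values on a basis are free; the extension sums the chosen values, each acted on by
  its coordinate times e_v.\<close>

lemma linear_extension:
  assumes v: "v \<in> verts Q" and B: "independent B" and h0: "\<And>b. b \<in> B \<Longrightarrow> h0 b \<in> N_at v"
  shows "\<exists>h. (\<forall>x\<in>span B. h x \<in> N_at v)
    \<and> (\<forall>x\<in>span B. \<forall>y\<in>span B. h (x + y) = h x + h y)
    \<and> (\<forall>c. \<forall>x\<in>span B. h (c *s x) = act (h x) (single (v, []) c))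
    \<and> (\<forall>b\<in>B. h b = h0 b)"
proof -
  \<comment> \<open>The default 0 outside \<open>B\<close> keeps all values in
    \<open>N_at v\<close>.\<close>
  define t where "t b c = act (if b \<in> B then h0 b else 0) (single (v, []) c)" for b c
  have in_N: "(if b \<in> B then h0 b else 0) \<in> N" for b
    using N_atD[OF h0, of b] by (simp add: N_zero)
  have t_in: "t b c \<in> N_at v" for b c
    unfolding t_def using act_path_in_N_at[OF in_N, of v "[]"] v by simp
  have t_zero: "t b 0 = 0" for b
    by (simp only: t_def single_zero act_zero_right[OF in_N])
  have t_add: "t b (c + d) = t b c + t b d" for b c d
    unfolding t_def single_add by (rule act_add_right[OF in_N]) (simp_all add: vertex_in_pathalg v)
  define h where "h x = lsum t (representation B x)" for x
  have fin: "finite {b. representation B x b \<noteq> 0}" for x by (rule finite_representation)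
  have h_sum: "h x = (\<Sum>b | representation B x b \<noteq> 0. t b (representation B x b))" for x
    by (simp add: h_def lsum_def)
  show ?thesis
  proof (intro exI conjI ballI allI)
    fix x assume x: "x \<in> span B"
    show "h x \<in> N_at v"
      unfolding h_sum by (rule sum_closed) (auto simp: N_at_zero N_at_add v t_in)
    show "h (x + y) = h x + h y" if y: "y \<in> span B" for y
    proof -
      have "representation B (x + y) = representation B x + representation B y"
        by (rule ext) (simp add: representation_add[OF B y x] plus_fun_apply)
      then show ?thesis unfolding h_def using fin t_zero t_add by (simp add: lsum_add)
    qed
    show "h (c *s x) = act (h x) (single (v, []) c)" for c
    proof -
      let ?S = "{b. representation B x b \<noteq> 0}"
      \<comment> \<open>For c = 0 the support shrinks, so the sum runs over the support belonging to
        x.\<close>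
      have "h (c *s x) = (\<Sum>b\<in>?S. t b (representation B (c *s x) b))"
        unfolding h_def
        by (rule lsum_superset[OF fin]) (auto simp: representation_scale[OF B x] t_zero)
      also have "\<dots> = (\<Sum>b\<in>?S. act (t b (representation B x b)) (single (v, []) c))"
        by (rule sum.cong[OF refl])
          (simp add: t_def act_act in_N[simplified] vertex_in_pathalg v pmult_single
            representation_scale[OF B x] mult.commute)
      also have "\<dots> = act (h x) (single (v, []) c)"
        unfolding h_sum using t_in N_atD
        by (intro additive_on_sum[where E = N, symmetric])
          (auto simp: N_zero N_add act_zero_left act_add_left vertex_in_pathalg v)
      finally show ?thesis .
    qed
  next
    fix b assume b: "b \<in> B"
    have "representation B b = single b 1"
      by (rule ext) (simp add: representation_basis[OF B b] single_def)
    then have "h b = t b 1" unfolding h_def by (simp add: t_zero)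
    then show "h b = h0 b" using h0[OF b] b by (simp add: t_def N_at_def)
  qed
qed

text \<open>\<open>F\<close> is read only at sources of supported arrows into v, as recursion along
  \<open>supported_arrows\<close> demands. Outside \<open>verts Q\<close> nothing is asked, because
  the recursion runs over the whole type.\<close>

definition local_section :: "('v \<Rightarrow> 'x \<Rightarrow> 'e) \<Rightarrow> 'v \<Rightarrow> ('x \<Rightarrow> 'e) \<Rightarrow> bool" where
  "local_section F v h \<longleftrightarrow> (v \<in> verts Q \<longrightarrow>
    (\<forall>x\<in>X v. h x \<in> N_at v \<and> f (h x) = single v x)
    \<and> (\<forall>x\<in>X v. \<forall>y\<in>X v. h (x + y) = h x + h y)
    \<and> (\<forall>c. \<forall>x\<in>X v. h (c *s x) = act (h x) (single (v, []) c))
    \<and> (\<forall>a\<in>arrs Q. tgt Q a = v \<and> X (src Q a) \<noteq> {0} \<longrightarrow>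
        (\<forall>x\<in>X (src Q a). h (XA a x) = act (F (src Q a) x) (single (src Q a, [a]) 1))))"

text \<open>Multiplying any preimage by e_v moves it into \<open>N_at v\<close> and keeps its
  image.\<close>

lemma preimage_exists:
  assumes "v \<in> verts Q" "x \<in> X v"
  shows "\<exists>z\<in>N_at v. f z = single v x"
proof -
  have "single v x \<in> f ` N" using surj single_in_M[OF assms] by simp
  then obtain z where z: "z \<in> N" "single v x = f z" by blast
  have "f (act z (single (v, []) 1)) = single v x"
    using z assms(1) by (simp add: f_act vertex_in_pathalg actM_single flip: z(2))
  moreover have "act z (single (v, []) 1) \<in> N_at v"
    using act_path_in_N_at[OF z(1), of v "[]" 1] assms(1) by simp
  ultimately show ?thesis by blast
qed

text \<open>Both sides are z times c a; this carries scalars along an arrow.\<close>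

lemma arrow_swap:
  assumes "z \<in> N" "a \<in> arrs Q"
  shows "act (act z (single (src Q a, []) c)) (single (src Q a, [a]) 1) =
    act (act z (single (src Q a, [a]) 1)) (single (tgt Q a, []) c)"
  using assms
  by (simp add: act_act vertex_in_pathalg arrow_in_pathalg src_in_verts tgt_in_verts pmult_single)

text \<open>The images of bases at the sources form an independent set, which extends to a basis of
  X_v. On the images the section is forced; on the other basis vectors any preimage will do.\<close>

lemma local_section_exists:
  assumes F: "\<And>w. (w, v) \<in> supported_arrows \<Longrightarrow> local_section F w (F w)"
  shows "\<exists>h. local_section F v h"
proof (cases "v \<in> verts Q")
  case v: True
  define A where "A = {a \<in> arrs Q. tgt Q a = v \<and> X (src Q a) \<noteq> {0}}"
  have A: "a \<in> arrs Q" "tgt Q a = v" "src Q a \<in> verts Q" if "a \<in> A" for a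
    using that src_in_verts by (auto simp: A_def)
  have F_src: "local_section F (src Q a) (F (src Q a))" if "a \<in> A" for a
    using F that by (force simp: A_def supported_arrows_def)
  have F_at: "F (src Q a) x \<in> N_at (src Q a)" "f (F (src Q a) x) = single (src Q a) x"
    and F_add: "y \<in> X (src Q a) \<Longrightarrow> F (src Q a) (x + y) = F (src Q a) x + F (src Q a) y"
    and F_scale: "F (src Q a) (c *s x) = act (F (src Q a) x) (single (src Q a, []) c)"
    if "a \<in> A" "x \<in> X (src Q a)" for a x y c
    using F_src[OF that(1)] A(3)[OF that(1)] that(2) by (auto simp: local_section_def)
  have "\<forall>w. \<exists>B. w \<in> verts Q \<longrightarrow> B \<subseteq> X w \<and> independent B \<and> X w \<subseteq> span B"
    by (metis basis_of_X)
  then obtain bas where bas: "\<And>w. w \<in> verts Q \<Longrightarrow> bas w \<subseteq> X w \<and> independent (bas w) \<and> X w \<subseteq> span (bas w)"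
    by metis
  define S where "S = (\<Union>a\<in>A. XA a ` bas (src Q a))"
  have "independent S"
    unfolding S_def using A bas by (intro incoming_images_independent[of A v]) auto
  moreover have "S \<subseteq> X v" unfolding S_def using A bas XA_in_X by blast
  ultimately obtain B where B: "S \<subseteq> B" "B \<subseteq> X v" "independent B" "X v \<subseteq> span B"
    using maximal_independent_subset_extend[of S "X v"] by blast
  have span_B: "span B = X v"
    using B(2,4) span_minimal[OF B(2) subspace_X[OF v]] by blast
  let ?img = "\<lambda>a b. act (F (src Q a) b) (single (src Q a, [a]) 1)"
  \<comment> \<open>Arrow and basis vector behind \<open>s\<close> are unique by
    \<open>incoming_disjoint\<close> and \<open>XA_inj\<close>, so the prescription can be stated
    for all of them at once.\<close>
  have h0_ex: "\<exists>z\<in>N_at v. f z = single v s \<and>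
      (\<forall>a\<in>A. \<forall>b\<in>bas (src Q a). s = XA a b \<longrightarrow> z = ?img a b)" if s: "s \<in> B" for s
  proof (cases "s \<in> S")
    case True
    then obtain a b where ab: "a \<in> A" "b \<in> bas (src Q a)" "s = XA a b" by (auto simp: S_def)
    have b: "b \<in> X (src Q a)" using bas[OF A(3)[OF ab(1)]] ab(2) by blast
    have "b \<noteq> 0" using bas[OF A(3)[OF ab(1)]] ab(2) dependent_zero by blast
    show ?thesis
    proof (intro bexI conjI ballI impI)
      note Fb = F_at[OF ab(1) b]
      show "?img a b \<in> N_at v"
        using act_path_in_N_at[OF N_atD[OF Fb(1)], of "src Q a" "[a]"] A[OF ab(1)] v
        by (simp add: is_path_Cons[OF quiver])
      show "f (?img a b) = single v s"
        using A[OF ab(1)] Fb ab(3) N_atD[OF Fb(1)]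
        by (simp add: f_act arrow_in_pathalg actM_single)
      fix a' b' assume ab': "a' \<in> A" "b' \<in> bas (src Q a')" "s = XA a' b'"
      have b': "b' \<in> X (src Q a')" using bas[OF A(3)[OF ab'(1)]] ab'(2) by blast
      have "a = a'"
        using incoming_disjoint[of a a' b b'] A[OF ab(1)] A[OF ab'(1)] b b' ab(3) ab'(3) \<open>b \<noteq> 0\<close> by simp
      moreover have "b = b'"
        using XA_inj[of a b b'] A(1)[OF ab(1)] b b' ab(3) ab'(3) \<open>a = a'\<close> by simp
      ultimately show "?img a b = ?img a' b'" by simp
    qed
  next
    case False
    then have "\<forall>a\<in>A. \<forall>b\<in>bas (src Q a). s \<noteq> XA a b" by (auto simp: S_def)
    moreover obtain z where "z \<in> N_at v" "f z = single v s" using preimage_exists[OF v] s B(2) by blast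
    ultimately show ?thesis by blast
  qed
  then obtain h0 where h0: "\<And>s. s \<in> B \<Longrightarrow> h0 s \<in> N_at v" "\<And>s. s \<in> B \<Longrightarrow> f (h0 s) = single v s"
    and h0_img: "\<And>s a b. s \<in> B \<Longrightarrow> a \<in> A \<Longrightarrow> b \<in> bas (src Q a) \<Longrightarrow> s = XA a b \<Longrightarrow> h0 s = ?img a b"
    by metis
  obtain h where h_at: "\<And>x. x \<in> X v \<Longrightarrow> h x \<in> N_at v"
    and h_add: "\<And>x y. x \<in> X v \<Longrightarrow> y \<in> X v \<Longrightarrow> h (x + y) = h x + h y"
    and h_scale: "\<And>c x. x \<in> X v \<Longrightarrow> h (c *s x) = act (h x) (single (v, []) c)"
    and h_basis: "\<And>b. b \<in> B \<Longrightarrow> h b = h0 b"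
    using linear_extension[of v B h0, OF v B(3) h0(1)] unfolding span_B by blast
  have h_zero: "h 0 = 0" using h_add[of 0 0] zero_in_X[OF v] by simp
  \<comment> \<open>The vectors that are lifted correctly form a subspace containing the
    basis.\<close>
  have "B \<subseteq> {x \<in> X v. f (h x) = single v x}" using B(2) h_basis h0(2) by auto
  moreover have "subspace {x \<in> X v. f (h x) = single v x}"
  proof (rule subspaceI)
    show "0 \<in> {x \<in> X v. f (h x) = single v x}" by (simp add: zero_in_X v h_zero f_zero)
    show "x + y \<in> {x \<in> X v. f (h x) = single v x}"
      if "x \<in> {x \<in> X v. f (h x) = single v x}" "y \<in> {x \<in> X v. f (h x) = single v x}" for x y
      using that by (simp add: add_in_X v h_add f_add N_atD[OF h_at] single_add)
    show "c *s x \<in> {x \<in> X v. f (h x) = single v x}"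
      if "x \<in> {x \<in> X v. f (h x) = single v x}" for c x
      using that by (simp add: scale_in_X v h_scale f_act N_atD[OF h_at] vertex_in_pathalg actM_single)
  qed
  ultimately have f_h: "f (h x) = single v x" if "x \<in> X v" for x
    using span_minimal[of B] B(4) that by blast
  have arrow: "h (XA a x) = ?img a x" if a: "a \<in> A" and x: "x \<in> X (src Q a)" for a x
  proof -
    note a' = A[OF a]
    \<comment> \<open>Again a subspace containing a basis; its closure under scalars is
      \<open>arrow_swap\<close>.\<close>
    let ?T = "{x \<in> X (src Q a). h (XA a x) = ?img a x}"
    have XA_v: "XA a x \<in> X v" if "x \<in> X (src Q a)" for x using XA_in_X[OF a'(1) that] a'(2) by simp
    have "bas (src Q a) \<subseteq> ?T"
    proof
      fix b assume b: "b \<in> bas (src Q a)"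
      then have "XA a b \<in> B" using a B(1) by (auto simp: S_def)
      then show "b \<in> ?T" using h_basis h0_img[OF _ a b refl] bas[OF a'(3)] b by auto
    qed
    moreover have "subspace ?T"
    proof (rule subspaceI)
      have "F (src Q a) 0 = 0"
        using F_add[OF a, of 0 0] zero_in_X[OF a'(3)] by simp
      then show "0 \<in> ?T"
        by (simp add: zero_in_X a'(3) XA_zero a'(1) h_zero act_zero_left arrow_in_pathalg)
      show "x + y \<in> ?T" if "x \<in> ?T" "y \<in> ?T" for x y
        using that by (simp add: add_in_X a'(3) XA_add a'(1) h_add XA_v F_add[OF a] act_add_left
            N_atD[OF F_at(1)[OF a]] arrow_in_pathalg)
      show "c *s x \<in> ?T" if "x \<in> ?T" for c x
        using that arrow_swap[OF N_atD[OF F_at(1)[OF a]] a'(1), of x c]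
        by (simp add: scale_in_X a'(3) XA_scale a'(1) h_scale XA_v F_scale[OF a] a'(2))
    qed
    ultimately have "span (bas (src Q a)) \<subseteq> ?T" by (rule span_minimal)
    then show ?thesis using bas[OF a'(3)] x by blast
  qed
  have "local_section F v h"
    unfolding local_section_def using h_at f_h h_add h_scale arrow by (auto simp: A_def)
  then show ?thesis by blast
qed (simp add: local_section_def)

text \<open>Well-founded choice: the predicate at v depends on \<open>F\<close> only at predecessors
  of v, and \<open>local_section_exists\<close> is the recursion step.\<close>

lemma compatible_sections_exist: "\<exists>F. \<forall>v. local_section F v (F v)"
proof (rule dependent_wf_choice[OF wf_supported_arrows])
  fix F G :: "'v \<Rightarrow> 'x \<Rightarrow> 'e" and v h
  assume "\<And>w. (w, v) \<in> supported_arrows \<Longrightarrow> F w = G w"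
  then have "F (src Q a) = G (src Q a)" if "a \<in> arrs Q" "tgt Q a = v" "X (src Q a) \<noteq> {0}" for a
    using that by (force simp: supported_arrows_def)
  then show "local_section F v h = local_section G v h"
    unfolding local_section_def by (intro arg_cong2[where f = "(\<longrightarrow>)"] arg_cong2[where f = "(\<and>)"] refl) auto
qed (rule local_section_exists)

text \<open>The section is the sum of the \<open>F v\<close> over the components. Compatibility with
  arrows extends to paths by induction and to KQ by additivity.\<close>

lemma section_exists: "\<exists>g. mod_hom Q M actM N act g \<and> (\<forall>m\<in>M. f (g m) = m)"
proof -
  obtain F where sec: "\<And>v. local_section F v (F v)" using compatible_sections_exist by blast
  have F_at: "F v x \<in> N_at v" and F_f: "f (F v x) = single v x"
    and F_add: "y \<in> X v \<Longrightarrow> F v (x + y) = F v x + F v y"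
    and F_scale: "F v (c *s x) = act (F v x) (single (v, []) c)"
    if "v \<in> verts Q" "x \<in> X v" for v x y c
    using sec[of v] that by (auto simp: local_section_def)
  have F_zero: "F v 0 = 0" if "v \<in> verts Q" for v
    using F_add[OF that, of 0 0] zero_in_X[OF that] by simp
  have F_arrow: "F (tgt Q a) (XA a x) = act (F (src Q a) x) (single (src Q a, [a]) 1)"
    if a: "a \<in> arrs Q" and x: "x \<in> X (src Q a)" for a x
  proof (cases "X (src Q a) = {0}")
    \<comment> \<open>\<open>local_section\<close> is silent about such arrows, but here x = 0 and
      both sides are 0.\<close>
    case True
    then show ?thesis using a x
      by (simp add: XA_zero F_zero src_in_verts tgt_in_verts act_zero_left arrow_in_pathalg)
  next
    case False
    then show ?thesis using sec[of "tgt Q a"] a x tgt_in_verts[OF a] by (auto simp: local_section_def)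
  qed
  have F_path: "F (path_tgt Q (v, as)) (transport x as) = act (F v x) (single (v, as) 1)"
    if "is_path Q (v, as)" "x \<in> X v" for v x as
    using that
  proof (induction as arbitrary: v x)
    case Nil
    then show ?case using F_at[of v x] by (simp add: N_at_def)
  next
    case (Cons a as)
    then have a: "a \<in> arrs Q" "src Q a = v" "is_path Q (tgt Q a, as)" by (simp_all add: is_path_Cons[OF quiver])
    have x: "x \<in> X (src Q a)" using Cons a by simp
    have Fx: "F v x \<in> N" using F_at[OF src_in_verts[OF a(1)] x] a(2) by (simp add: N_atD)
    have "F (path_tgt Q (tgt Q a, as)) (transport (XA a x) as) =
        act (F (tgt Q a) (XA a x)) (single (tgt Q a, as) 1)"
      by (rule Cons.IH[OF a(3) XA_in_X[OF a(1) x]])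
    also have "\<dots> = act (F v x) (single (v, a # as) 1)"
      using F_arrow[OF a(1) x] Fx arrow_in_pathalg[OF a(1), of "1::'k"] a
      by (simp add: act_act single_in_pathalg pmult_single)
    finally show ?case by simp
  qed
  \<comment> \<open>The default outside \<open>verts Q\<close> secures \<open>F' v 0 = 0\<close> for
    every v, as \<open>lsum_add\<close> requires.\<close>
  define F' where "F' v x = (if v \<in> verts Q then F v x else 0)" for v x
  define g where "g m = lsum F' m" for m
  have F'_zero: "F' v 0 = 0" for v by (simp add: F'_def F_zero)
  have g_single: "g (single v x) = F v x" if "v \<in> verts Q" for v x
    using that by (simp add: g_def F'_zero) (simp add: F'_def)
  have g_add: "g (m + m') = g m + g m'" if "m \<in> M" "m' \<in> M" for m m'
    unfolding g_def
  proof (rule lsum_add)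
    show "F' v (m v + m' v) = F' v (m v) + F' v (m' v)" for v
      using that by (simp add: F'_def F_add component_in_X)
  qed (use that in \<open>simp_all add: F'_zero G_carrier_def\<close>)
  have g_zero: "g 0 = 0" by (simp add: g_def)
  have g_in: "g m \<in> N" if "m \<in> M" for m
    using that
  proof (induction rule: M_induct)
    case zero
    then show ?case by (simp add: g_zero N_zero)
  next
    case (single v x m)
    then show ?case using F_at[of v x] by (simp add: g_add single_in_M g_single N_add N_atD)
  qed
  have f_g: "f (g m) = m" if "m \<in> M" for m
    using that
  proof (induction rule: M_induct)
    case zero
    then show ?case by (simp add: g_zero f_zero)
  next
    case (single v x m)
    then show ?case using F_at[of v x]
      by (simp add: g_add single_in_M g_single f_add N_atD g_in F_f)
  qed
  have g_act: "g (actM m r) = act (g m) r" if m: "m \<in> M" and r: "r \<in> pathalg Q" for m r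
    using m
  proof (induction rule: M_induct)
    case zero
    then show ?case using r by (simp add: g_zero actM_zero_left act_zero_left)
  next
    case (single v x m)
    note vx = single(1,2)
    have Fx: "F v x \<in> N_at v" by (rule F_at[OF vx])
    have "g (actM (single v x) r) = act (F v x) r"
      using r
    proof (induction rule: pathalg_induct)
      case zero
      then show ?case by (simp add: g_zero act_zero_right N_atD[OF Fx])
    next
      case (single p c r)
      obtain w as where p: "p = (w, as)" by (cases p)
      have path: "is_path Q (w, as)" using single(1) p by simp
      note t = path_tgt_in_verts[OF quiver path]
      have "g (actM (single v x) (single p c)) = act (F v x) (single p c)"
      proof (cases "w = v")
        case True
        have tx: "transport x as \<in> X (path_tgt Q (v, as))"
          using transport_in_X[of v as x] path True vx(2) by simp
        have "g (actM (single v x) (single p c)) = F (path_tgt Q (v, as)) (c *s transport x as)"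
          using t by (simp add: p True actM_single g_single)
        \<comment> \<open>The scalar acts at the end of the path, as c times the trivial path at its
          target.\<close>
        also have "\<dots> = act (act (F v x) (single (v, as) 1)) (single (path_tgt Q (v, as), []) c)"
          using F_scale[OF _ tx] t F_path[OF _ vx(2)] path by (simp add: True)
        also have "\<dots> = act (F v x) (single p c)"
          using path t by (simp add: p True act_act N_atD[OF Fx] single_in_pathalg pmult_single)
        finally show ?thesis .
      next
        case False
        have "actM (single v x) (single p c) = 0"
          using False path by (simp add: p actM_single transport_zero)
        then show ?thesis using act_path_mismatch[OF Fx vx(1) path False] by (simp add: p g_zero)
      qed
      then show ?case using single vx
        by (simp add: actM_add_right single_in_pathalg g_add actM_in_M single_in_M act_add_right N_atD[OF Fx])
    qed
    then show ?case using single r N_atD[OF Fx]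
      by (simp add: actM_add_left single_in_M g_add actM_in_M g_single act_add_left g_in)
  qed
  have "mod_hom Q M actM N act g"
    unfolding mod_hom_def using g_in g_add g_act by blast
  then show ?thesis using f_g by blast
qed

end

section \<open>Cycles in closures, and the conclusion\<close>

text \<open>A cycle through v stays inside the closure of \<open>{v}\<close>, since the source of
  each of its arrows is the end of an initial segment.\<close>

lemma closure_quiver_no_cycle:
  assumes Q: "is_quiver Q" and p: "is_path Q (v, as)" "as \<noteq> []"
    and acyclic: "acyclic_quiver (closure_quiver Q {v})"
  shows "path_tgt Q (v, as) \<noteq> v"
proof -
  let ?C = "closure_quiver Q {v}"
  have sel: "verts ?C = {w. \<exists>p. is_path Q p \<and> fst p \<in> {v} \<and> path_tgt Q p = w}"
    "arrs ?C = {a \<in> arrs Q. src Q a \<in> verts ?C}" "src ?C = src Q" "tgt ?C = tgt Q"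
    by (simp_all add: closure_quiver_def Let_def)
  have tgt: "path_tgt ?C p = path_tgt Q p" for p by (simp add: path_tgt_def sel)
  have chain: "arrows_chain ?C bs = arrows_chain Q bs" for bs
    by (induction Q bs rule: arrows_chain.induct) (simp_all add: closure_quiver_def Let_def)
  have verts: "path_tgt Q (v, bs) \<in> verts ?C" if "is_path Q (v, bs)" for bs
    using that unfolding sel(1) by force
  have "set as \<subseteq> arrs ?C"
  proof
    fix a assume "a \<in> set as"
    then obtain bs cs where as: "as = bs @ a # cs" by (auto simp: in_set_conv_decomp)
    then show "a \<in> arrs ?C"
      using p(1) verts[of bs] by (auto simp: is_path_append[OF Q] is_path_Cons[OF Q] sel(2))
  qed
  moreover have "v \<in> verts ?C" using verts[of "[]"] p(1) by (simp add: is_path_def)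
  ultimately have "is_path ?C (v, as)" using p(1) by (simp add: is_path_def chain sel(3))
  then show ?thesis using acyclic p(2) unfolding acyclic_quiver_def tgt by fastforce
qed

theorem theorem1p11:
  fixes Q :: "('v, 'a) quiver"
    and scale :: "'k::field \<Rightarrow> 'x::ab_group_add \<Rightarrow> 'x"
    and X :: "'v \<Rightarrow> 'x set"
    and XA :: "'a \<Rightarrow> 'x \<Rightarrow> 'x"
  assumes "alg_closed TYPE('k)"
    and "is_quiver Q"
    and "connected_quiver Q"
    and "\<forall>P. finite P \<and> P \<subseteq> verts Q \<longrightarrow>
           finite_quiver (closure_quiver Q P) \<and> acyclic_quiver (closure_quiver Q P)"
    and "fd_representation Q scale X XA"
    and "ext_pos_vanish TYPE('i) Q (G_carrier Q X) (G_act Q XA scale)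
           (pathalg Q) (pmult Q :: (('v, 'a) qpath \<Rightarrow> 'k) \<Rightarrow> _)"
  shows "projective_mod Q (G_carrier Q X) (G_act Q XA scale) TYPE('e::ab_group_add)"
proof -
  interpret vector_space scale using assms(5) by (simp add: fd_representation_def)
  interpret quiver_rep scale Q X XA by unfold_locales (fact assms)+
  interpret split_rep scale Q X XA
  proof
    fix p assume p: "is_path Q p" "snd p \<noteq> []"
    have "acyclic_quiver (closure_quiver Q {fst p})"
      using assms(4) p(1) by (simp add: is_path_def)
    then show "path_tgt Q p \<noteq> fst p"
      using closure_quiver_no_cycle[OF quiver, of "fst p" "snd p"] p by simp
  next
    fix lam :: "'a \<Rightarrow> 'x \<Rightarrow> 'k"
    assume lam: "\<And>a x y. lam a (x + y) = lam a x + lam a y" "\<And>a c x. lam a (scale c x) = c * lam a x"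
    interpret arrow_functionals scale Q X XA lam by unfold_locales (fact lam)+
    obtain psi where psi_in: "\<And>m. m \<in> M \<Longrightarrow> psi m \<in> pathalg Q"
      and psi_add: "\<And>m m'. m \<in> M \<Longrightarrow> m' \<in> M \<Longrightarrow> psi (m + m') = psi m + psi m'"
      and psi_arr: "\<And>m a. m \<in> M \<Longrightarrow> a \<in> arrs Q \<Longrightarrow> psi (actM m (single (src Q a, [a]) 1)) =
        pmult Q (psi m) (single (src Q a, [a]) 1) + single (tgt Q a, []) (lam a (m (src Q a)))"
      using cocycle_splits[OF assms(6)] by blast
    show "\<exists>psi :: 'v \<Rightarrow> 'x \<Rightarrow> ('v, 'a) qpath \<Rightarrow> 'k.
        (\<forall>v\<in>verts Q. \<forall>x\<in>X v. psi v x \<in> pathalg Q)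
        \<and> (\<forall>v\<in>verts Q. \<forall>x\<in>X v. \<forall>y\<in>X v. psi v (x + y) = psi v x + psi v y)
        \<and> (\<forall>a\<in>arrs Q. \<forall>x\<in>X (src Q a). psi (tgt Q a) (XA a x) =
              pmult Q (psi (src Q a) x) (single (src Q a, [a]) 1) + single (tgt Q a, []) (lam a x))"
    \<comment> \<open>The witness sends v and x to \<open>psi (single v x)\<close>.\<close>
    proof (intro exI conjI ballI)
      fix a x assume a: "a \<in> arrs Q" and x: "x \<in> X (src Q a)"
      show "psi (single (tgt Q a) (XA a x)) =
          pmult Q (psi (single (src Q a) x)) (single (src Q a, [a]) 1) + single (tgt Q a, []) (lam a x)"
        using psi_arr[OF single_in_M[OF src_in_verts[OF a] x] a] by (simp add: actM_single)
    qed (simp_all add: psi_in psi_add single_in_M single_add)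
  qed
  show ?thesis
    unfolding projective_mod_def
  proof (intro allI impI)
    fix N :: "'e set" and act f
    assume "rmodule Q N act \<and> mod_hom Q N act M actM f \<and> f ` N = M"
    then interpret epi_onto_rep scale Q X XA N act f by unfold_locales auto
    show "\<exists>g. mod_hom Q M actM N act g \<and> (\<forall>m\<in>M. f (g m) = m)" by (rule section_exists)
  qed
qed

end
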